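(* Let $\mathcal{G}=(X,*,\mathrm{typ})$ be a geometry over some finite set $I$, let $G$ be a group of automorphisms of $\mathcal{G}$, and for each $i\in I$ let $w^i_1,\ldots,w^i_{t_i}$ be $G$-orbit representatives of the elements of type $i$ of $\mathcal{G}$ such that (i) $W:=\bigcup_{i\in I}\{w^i_1,\ldots,w^i_{t_i}\}$ is a hall, and (ii) if $V\subseteq W$ is a flag, the action of $G$ on the pregeometry over $\mathrm{typ}(V)$ consisting of all elements of the $G$-orbits $G.x$, $x\in V$, is flag-transitive. Let $k\le|I|$, assume that all residues of rank greater or equal $k$ with respect to subsets of $W$ (i.e. all residues $\mathcal{G}_U$ of rank at least $k$, where $U\subseteq W$ is a flag) are simply connected, and let $\mathcal{A}(\mathcal{G},G,W)$ and $\mathcal{A}_{(k)}(\mathcal{G},G,W)$ be the amalgam of maximal parabolics, respectively rank $k$ parabolics, of $\mathcal{G}$ with respect to $G$ and $W$. Then $$G=\mathcal{U}(\mathcal{A}(\mathcal{G},G,W))=\mathcal{U}(\mathcal{A}_{(k)}(\mathcal{G},G,W)).$$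
   Context: A pregeometry over a set $I$ is a triple $(X,*,\mathrm{typ})$ with a set $X$, a symmetric reflexive incidence relation $*$ on $X$ and a surjection $\mathrm{typ}:X\to I$ such that $x*y$ and $\mathrm{typ}(x)=\mathrm{typ}(y)$ imply $x=y$; its rank is $|I|$. A flag is a set of pairwise incident elements (the empty set is a flag); a chamber is a flag $F$ with $\mathrm{typ}(F)=I$. A geometry is a pregeometry in which every flag is contained in a chamber. It is connected if the graph $(X,* )$ is connected. A subset $W\subseteq X$ is a hall if $\mathrm{typ}(W)=I$ and every $V\subseteq W$ on which $\mathrm{typ}$ is injective is a flag. The residue $\mathcal{G}_F$ of a flag $F$ is the pregeometry of all $x\in X$ with $\mathrm{typ}(x)\notin\mathrm{typ}(F)$ and $F\cup\{x\}$ a flag, with induced incidence and type function; $\mathcal{G}_\emptyset=\mathcal{G}$. In a geometry over $I$ the residue of $F$ has rank $|I|-|F|$. An automorphism is a type-preserving permutation of $X$ preserving incidence in both directions; a group of automorphisms is a subgroup of $\mathrm{Aut}(\mathcal{G})$. An action by automorphisms is flag-transitive if any two flags of the same type are in one orbit. For a nonempty flag $U\subseteq W$ let $G_U$ be the stabilizer of $U$ in $G$ (fixing every element of $U$); it is a parabolic of rank $|I|-|U|$. $\mathcal{A}(\mathcal{G},G,W)$ is the family $(G_U)_{\emptyset\neq U\subseteq W\text{ a flag}}$ with the inclusions $G_{U'}\hookrightarrow G_U$ for $U\subseteq U'$ as identification maps. $\mathcal{A}_{(k)}(\mathcal{G},G,W)$, the amalgam of rank $k$ parabolics, is the subamalgam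 of $\mathcal{A}(\mathcal{G},G,W)$ consisting of all parabolics of rank at most $k$ (so it equals $\mathcal{A}(\mathcal{G},G,W)$ for $k\geq|I|-1$). The universal completion $\mathcal{U}(\mathcal{A})$ of such an amalgam is the group with one generator $u_g$ for every element $g$ of the disjoint union of its groups, with relations $u_xu_y=u_z$ whenever $xy=z$ in one of the groups, and $u_x=u_y$ whenever an identification map sends $x$ to $y$. An equality $G=\mathcal{U}(\mathcal{A})$ means that the canonical homomorphism $\mathcal{U}(\mathcal{A})\to G$, $u_g\mapsto g$, is an isomorphism. Homotopy: a path is a sequence $(x_0,\ldots,x_k)$ of elements with consecutive ones incident; a cycle based at $x$ is a path with $x_0=x_k=x$. Two paths are homotopically equivalent if one is obtained from the other by finitely many insertions or deletions of cycles of length 1, 2 or 3. The fundamental group at $x$ is the group of equivalence classes of cycles based at $x$ under concatenation. A (pre)geometry is simply connected if it is connected and its fundamental group is trivial. *)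

theory Defs
  imports
    "HOL-Algebra.Bij"
    "HOL-Algebra.Group_Action"
    "HOL-Algebra.Elementary_Groups"
begin

section \<open>Pregeometries\<close>

text \<open>Only the values of \<open>inc\<close> and \<open>ty\<close> on \<open>elts\<close> matter, so that passing to the
  induced structure on a subset of the elements just replaces \<open>elts\<close> and \<open>types\<close>.\<close>

record ('x, 'i) pregeom =
  elts :: "'x set"
  inc :: "'x \<Rightarrow> 'x \<Rightarrow> bool"
  ty :: "'x \<Rightarrow> 'i"
  types :: "'i set"

definition pregeometry :: "('x, 'i) pregeom \<Rightarrow> bool" where
  "pregeometry \<Gamma> \<longleftrightarrow>
     reflp_on (elts \<Gamma>) (inc \<Gamma>) \<and> symp_on (elts \<Gamma>) (inc \<Gamma>) \<and>
     ty \<Gamma> ` elts \<Gamma> = types \<Gamma> \<and>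
     (\<forall>x\<in>elts \<Gamma>. \<forall>y\<in>elts \<Gamma>. inc \<Gamma> x y \<and> ty \<Gamma> x = ty \<Gamma> y \<longrightarrow> x = y)"

definition rank :: "('x, 'i) pregeom \<Rightarrow> nat" where
  "rank \<Gamma> = card (types \<Gamma>)"

definition flag :: "('x, 'i) pregeom \<Rightarrow> 'x set \<Rightarrow> bool" where
  "flag \<Gamma> F \<longleftrightarrow> F \<subseteq> elts \<Gamma> \<and> (\<forall>x\<in>F. \<forall>y\<in>F. inc \<Gamma> x y)"

definition chamber :: "('x, 'i) pregeom \<Rightarrow> 'x set \<Rightarrow> bool" where
  "chamber \<Gamma> C \<longleftrightarrow> flag \<Gamma> C \<and> ty \<Gamma> ` C = types \<Gamma>"

definition geometry :: "('x, 'i) pregeom \<Rightarrow> bool" where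
  "geometry \<Gamma> \<longleftrightarrow> pregeometry \<Gamma> \<and> (\<forall>F. flag \<Gamma> F \<longrightarrow> (\<exists>C. chamber \<Gamma> C \<and> F \<subseteq> C))"

definition hall :: "('x, 'i) pregeom \<Rightarrow> 'x set \<Rightarrow> bool" where
  "hall \<Gamma> W \<longleftrightarrow> W \<subseteq> elts \<Gamma> \<and> ty \<Gamma> ` W = types \<Gamma> \<and>
     (\<forall>V\<subseteq>W. inj_on (ty \<Gamma>) V \<longrightarrow> flag \<Gamma> V)"

definition residue :: "('x, 'i) pregeom \<Rightarrow> 'x set \<Rightarrow> ('x, 'i) pregeom" where
  "residue \<Gamma> F =
     \<Gamma>\<lparr>elts := {x \<in> elts \<Gamma>. ty \<Gamma> x \<notin> ty \<Gamma> ` F \<and> flag \<Gamma> (insert x F)},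
       types := types \<Gamma> - ty \<Gamma> ` F\<rparr>"

section \<open>Homotopy\<close>

definition is_path :: "('x, 'i) pregeom \<Rightarrow> 'x list \<Rightarrow> bool" where
  "is_path \<Gamma> p \<longleftrightarrow> p \<noteq> [] \<and> set p \<subseteq> elts \<Gamma> \<and> successively (inc \<Gamma>) p"

text \<open>The path \<open>(x\<^sub>0, \<dots>, x\<^sub>k)\<close> is a list with \<open>k + 1\<close> entries and has length \<open>k\<close>.\<close>

definition path_length :: "'x list \<Rightarrow> nat" where
  "path_length p = length p - 1"

definition is_cycle :: "('x, 'i) pregeom \<Rightarrow> 'x \<Rightarrow> 'x list \<Rightarrow> bool" where
  "is_cycle \<Gamma> x p \<longleftrightarrow> is_path \<Gamma> p \<and> hd p = x \<and> last p = x"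

text \<open>Inserting a cycle \<open>c\<close> based at \<open>x\<close> at an occurrence of \<open>x\<close> in a path.\<close>

definition cycle_insertion :: "('x, 'i) pregeom \<Rightarrow> ('x list \<times> 'x list) set" where
  "cycle_insertion \<Gamma> = {(p @ [x] @ q, p @ c @ q) | p x q c.
     is_path \<Gamma> (p @ [x] @ q) \<and> is_cycle \<Gamma> x c \<and> path_length c \<in> {1, 2, 3}}"

definition homotopy :: "('x, 'i) pregeom \<Rightarrow> ('x list \<times> 'x list) set" where
  "homotopy \<Gamma> = (cycle_insertion \<Gamma> \<union> (cycle_insertion \<Gamma>)\<inverse>)\<^sup>*"

definition fundamental_group :: "('x, 'i) pregeom \<Rightarrow> 'x \<Rightarrow> 'x list set monoid" where
  "fundamental_group \<Gamma> x =
     \<lparr>carrier = {p. is_cycle \<Gamma> x p} // homotopy \<Gamma>,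
      mult = (\<lambda>A B. \<Union>a\<in>A. \<Union>b\<in>B. homotopy \<Gamma> `` {a @ tl b}),
      one = homotopy \<Gamma> `` {[x]}\<rparr>"

definition connected_geom :: "('x, 'i) pregeom \<Rightarrow> bool" where
  "connected_geom \<Gamma> \<longleftrightarrow>
     (\<forall>x\<in>elts \<Gamma>. \<forall>y\<in>elts \<Gamma>. \<exists>p. is_path \<Gamma> p \<and> hd p = x \<and> last p = y)"

definition simply_connected_geom :: "('x, 'i) pregeom \<Rightarrow> bool" where
  "simply_connected_geom \<Gamma> \<longleftrightarrow>
     connected_geom \<Gamma> \<and> (\<forall>x\<in>elts \<Gamma>. trivial_group (fundamental_group \<Gamma> x))"

section \<open>Groups of automorphisms\<close>

definition geom_auts :: "('x, 'i) pregeom \<Rightarrow> ('x \<Rightarrow> 'x) set" where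
  "geom_auts \<Gamma> = {g \<in> Bij (elts \<Gamma>).
     (\<forall>x\<in>elts \<Gamma>. ty \<Gamma> (g x) = ty \<Gamma> x) \<and>
     (\<forall>x\<in>elts \<Gamma>. \<forall>y\<in>elts \<Gamma>. inc \<Gamma> (g x) (g y) \<longleftrightarrow> inc \<Gamma> x y)}"

definition aut_group :: "('x, 'i) pregeom \<Rightarrow> ('x \<Rightarrow> 'x) monoid" where
  "aut_group \<Gamma> = (BijGroup (elts \<Gamma>))\<lparr>carrier := geom_auts \<Gamma>\<rparr>"

text \<open>A group \<open>G\<close> of automorphisms is given by its carrier, a subgroup of \<open>aut_group \<Gamma>\<close>.\<close>

abbreviation aut_subgroup :: "('x, 'i) pregeom \<Rightarrow> ('x \<Rightarrow> 'x) set \<Rightarrow> ('x \<Rightarrow> 'x) monoid" where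
  "aut_subgroup \<Gamma> G \<equiv> (aut_group \<Gamma>)\<lparr>carrier := G\<rparr>"

abbreviation geom_orbit :: "('x, 'i) pregeom \<Rightarrow> ('x \<Rightarrow> 'x) set \<Rightarrow> 'x \<Rightarrow> 'x set" where
  "geom_orbit \<Gamma> G x \<equiv> orbit (aut_subgroup \<Gamma> G) (\<lambda>g. g) x"

definition flag_transitive :: "('x \<Rightarrow> 'x) set \<Rightarrow> ('x, 'i) pregeom \<Rightarrow> bool" where
  "flag_transitive G \<Gamma> \<longleftrightarrow>
     (\<forall>F F'. flag \<Gamma> F \<and> flag \<Gamma> F' \<and> ty \<Gamma> ` F = ty \<Gamma> ` F' \<longrightarrow> (\<exists>g\<in>G. g ` F = F'))"

definition orbit_pregeom :: "('x, 'i) pregeom \<Rightarrow> ('x \<Rightarrow> 'x) set \<Rightarrow> 'x set \<Rightarrow> ('x, 'i) pregeom" where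
  "orbit_pregeom \<Gamma> G V =
     \<Gamma>\<lparr>elts := (\<Union>x\<in>V. geom_orbit \<Gamma> G x), types := ty \<Gamma> ` V\<rparr>"

definition orbit_representatives ::
  "('x, 'i) pregeom \<Rightarrow> ('x \<Rightarrow> 'x) set \<Rightarrow> 'i \<Rightarrow> nat \<Rightarrow> (nat \<Rightarrow> 'x) \<Rightarrow> bool" where
  "orbit_representatives \<Gamma> G i n w \<longleftrightarrow>
     (\<forall>j\<in>{1..n}. w j \<in> elts \<Gamma> \<and> ty \<Gamma> (w j) = i) \<and>
     (\<forall>x\<in>elts \<Gamma>. ty \<Gamma> x = i \<longrightarrow> (\<exists>!j. j \<in> {1..n} \<and> x \<in> geom_orbit \<Gamma> G (w j)))"

definition parabolic :: "('x \<Rightarrow> 'x) set \<Rightarrow> 'x set \<Rightarrow> ('x \<Rightarrow> 'x) set" where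
  "parabolic G U = {g \<in> G. \<forall>u\<in>U. g u = u}"

section \<open>Groups given by generators and relations\<close>

text \<open>A word is a list of generators with exponents: \<open>(s, True)\<close> stands for \<open>s\<close> and
  \<open>(s, False)\<close> for the inverse of \<open>s\<close>.\<close>

type_synonym 's word = "('s \<times> bool) list"

definition words :: "'s set \<Rightarrow> 's word set" where
  "words S = lists (S \<times> UNIV)"

inductive_set pres_rel :: "'s set \<Rightarrow> ('s word \<times> 's word) set \<Rightarrow> ('s word \<times> 's word) set"
  for S R where
  refl: "w \<in> words S \<Longrightarrow> (w, w) \<in> pres_rel S R"
| sym: "(v, w) \<in> pres_rel S R \<Longrightarrow> (w, v) \<in> pres_rel S R"
| trans: "(u, v) \<in> pres_rel S R \<Longrightarrow> (v, w) \<in> pres_rel S R \<Longrightarrow> (u, w) \<in> pres_rel S R"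
| append: "(v, v') \<in> pres_rel S R \<Longrightarrow> (w, w') \<in> pres_rel S R \<Longrightarrow> (v @ w, v' @ w') \<in> pres_rel S R"
| cancel: "s \<in> S \<Longrightarrow> ([(s, b), (s, \<not> b)], []) \<in> pres_rel S R"
| relator: "(v, w) \<in> R \<Longrightarrow> v \<in> words S \<Longrightarrow> w \<in> words S \<Longrightarrow> (v, w) \<in> pres_rel S R"

definition presented_group :: "'s set \<Rightarrow> ('s word \<times> 's word) set \<Rightarrow> 's word set monoid" where
  "presented_group S R =
     \<lparr>carrier = words S // pres_rel S R,
      mult = (\<lambda>A B. \<Union>a\<in>A. \<Union>b\<in>B. pres_rel S R `` {a @ b}),
      one = pres_rel S R `` {[]}\<rparr>"

section \<open>Amalgams and universal completions\<close>

text \<open>A family of groups \<open>grp j\<close>, \<open>j \<in> index\<close>, with an identification map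
  \<open>amap i j\<close> from \<open>grp i\<close> to \<open>grp j\<close> for every \<open>(i, j) \<in> arrows\<close>.\<close>

record ('j, 'a) amalgam =
  index :: "'j set"
  grp :: "'j \<Rightarrow> 'a monoid"
  arrows :: "('j \<times> 'j) set"
  amap :: "'j \<Rightarrow> 'j \<Rightarrow> 'a \<Rightarrow> 'a"

definition subamalgam :: "('j, 'a) amalgam \<Rightarrow> 'j set \<Rightarrow> ('j, 'a) amalgam" where
  "subamalgam A J = A\<lparr>index := index A \<inter> J, arrows := arrows A \<inter> J \<times> J\<rparr>"

definition amalgam_gens :: "('j, 'a) amalgam \<Rightarrow> ('j \<times> 'a) set" where
  "amalgam_gens A = (SIGMA j:index A. carrier (grp A j))"

definition amalgam_rels :: "('j, 'a) amalgam \<Rightarrow> (('j \<times> 'a) word \<times> ('j \<times> 'a) word) set" where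
  "amalgam_rels A =
     {([((j, x), True), ((j, y), True)], [((j, x \<otimes>\<^bsub>grp A j\<^esub> y), True)]) | j x y.
        j \<in> index A \<and> x \<in> carrier (grp A j) \<and> y \<in> carrier (grp A j)} \<union>
     {([((i, x), True)], [((j, amap A i j x), True)]) | i j x.
        (i, j) \<in> arrows A \<and> x \<in> carrier (grp A i)}"

definition universal_completion :: "('j, 'a) amalgam \<Rightarrow> ('j \<times> 'a) word set monoid" where
  "universal_completion A = presented_group (amalgam_gens A) (amalgam_rels A)"

definition word_value :: "('a, 'm) monoid_scheme \<Rightarrow> ('j \<times> 'a) word \<Rightarrow> 'a" where
  "word_value H w =
     foldr (\<lambda>((j, g), b) a. (if b then g else inv\<^bsub>H\<^esub> g) \<otimes>\<^bsub>H\<^esub> a) w \<one>\<^bsub>H\<^esub>"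

text \<open>For an amalgam of subgroups of \<open>H\<close> with inclusions as identification maps,
  \<open>word_value H\<close> is constant on the elements of the universal completion, and
  \<open>canonical_hom H\<close> is the homomorphism sending the class of a generator \<open>(j, g)\<close> to \<open>g\<close>.\<close>

definition canonical_hom :: "('a, 'm) monoid_scheme \<Rightarrow> ('j \<times> 'a) word set \<Rightarrow> 'a" where
  "canonical_hom H C = the_elem (word_value H ` C)"

text \<open>Larger flags have smaller stabilizers, so there is an arrow from \<open>U'\<close> to \<open>U\<close>
  whenever \<open>U \<subseteq> U'\<close>.\<close>

definition parabolic_amalgam ::
  "('x, 'i) pregeom \<Rightarrow> ('x \<Rightarrow> 'x) set \<Rightarrow> 'x set \<Rightarrow> ('x set, 'x \<Rightarrow> 'x) amalgam" where
  "parabolic_amalgam \<Gamma> G W =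
     \<lparr>index = {U. U \<noteq> {} \<and> U \<subseteq> W \<and> flag \<Gamma> U},
      grp = (\<lambda>U. aut_subgroup \<Gamma> (parabolic G U)),
      arrows = {(U', U). U \<noteq> {} \<and> U \<subseteq> U' \<and> U' \<subseteq> W \<and> flag \<Gamma> U'},
      amap = (\<lambda>U' U g. g)\<rparr>"

definition parabolic_amalgam_rank ::
  "nat \<Rightarrow> ('x, 'i) pregeom \<Rightarrow> ('x \<Rightarrow> 'x) set \<Rightarrow> 'x set \<Rightarrow> ('x set, 'x \<Rightarrow> 'x) amalgam" where
  "parabolic_amalgam_rank k \<Gamma> G W =
     subamalgam (parabolic_amalgam \<Gamma> G W) {U. rank \<Gamma> - card U \<le> k}"

section \<open>Well-definedness\<close>

lemma subgroup_geom_auts: "subgroup (geom_auts \<Gamma>) (BijGroup (elts \<Gamma>))"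
proof -
  let ?X = "elts \<Gamma>" and ?B = "BijGroup (elts \<Gamma>)"
  interpret B: group ?B by (rule group_BijGroup)
  show ?thesis
  proof (rule B.subgroupI)
    show "geom_auts \<Gamma> \<subseteq> carrier ?B" by (auto simp: geom_auts_def BijGroup_def)
    have "(\<lambda>x\<in>?X. x) \<in> geom_auts \<Gamma>" by (auto simp: geom_auts_def id_Bij)
    then show "geom_auts \<Gamma> \<noteq> {}" by blast
  next
    fix g assume g: "g \<in> geom_auts \<Gamma>"
    then have gB: "g \<in> Bij ?X" by (simp add: geom_auts_def)
    have i: "inv\<^bsub>?B\<^esub> g = (\<lambda>x\<in>?X. inv_into ?X g x)" using gB by (rule inv_BijGroup)
    have iB: "(\<lambda>x\<in>?X. inv_into ?X g x) \<in> Bij ?X" using gB by (rule restrict_inv_into_Bij)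
    have k: "inv_into ?X g x \<in> ?X" "g (inv_into ?X g x) = x" if "x \<in> ?X" for x
      using gB that by (auto simp: Bij_def bij_betw_def f_inv_into_f inv_into_into)
    have t: "ty \<Gamma> (inv_into ?X g x) = ty \<Gamma> x" if "x \<in> ?X" for x
    proof -
      have "ty \<Gamma> (g (inv_into ?X g x)) = ty \<Gamma> (inv_into ?X g x)"
        using g k(1)[OF that] unfolding geom_auts_def by blast
      then show ?thesis by (simp add: k(2)[OF that])
    qed
    have n: "inc \<Gamma> (inv_into ?X g x) (inv_into ?X g y) = inc \<Gamma> x y"
      if "x \<in> ?X" "y \<in> ?X" for x y
    proof -
      have "inc \<Gamma> (g (inv_into ?X g x)) (g (inv_into ?X g y)) =
          inc \<Gamma> (inv_into ?X g x) (inv_into ?X g y)"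
        using g k(1)[OF that(1)] k(1)[OF that(2)] unfolding geom_auts_def by blast
      then show ?thesis by (simp add: k(2)[OF that(1)] k(2)[OF that(2)])
    qed
    show "inv\<^bsub>?B\<^esub> g \<in> geom_auts \<Gamma>"
      unfolding i geom_auts_def using iB by (simp add: t n)
  next
    fix g h assume gh: "g \<in> geom_auts \<Gamma>" "h \<in> geom_auts \<Gamma>"
    have B: "g \<in> Bij ?X" "h \<in> Bij ?X" using gh by (auto simp: geom_auts_def)
    have h: "h x \<in> ?X" if "x \<in> ?X" for x
      using B that by (auto dest: Bij_imp_funcset)
    show "g \<otimes>\<^bsub>?B\<^esub> h \<in> geom_auts \<Gamma>"
      using gh B compose_Bij[OF B] h by (simp add: geom_auts_def BijGroup_def compose_eq)
  qed
qed

lemma group_aut_group: "group (aut_group \<Gamma>)"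
  unfolding aut_group_def
  by (rule subgroup.subgroup_is_group[OF subgroup_geom_auts group_BijGroup])

lemma UN_UN_const:
  assumes "\<And>a b. a \<in> A \<Longrightarrow> b \<in> B \<Longrightarrow> f a b = c" "a \<in> A" "b \<in> B"
  shows "(\<Union>a\<in>A. \<Union>b\<in>B. f a b) = c"
  using assms by blast

subsection \<open>Presented groups\<close>

lemma pres_rel_words: "(v, w) \<in> pres_rel S R \<Longrightarrow> v \<in> words S \<and> w \<in> words S"
  by (induction rule: pres_rel.induct) (auto simp: words_def)

lemma equiv_pres_rel: "equiv (words S) (pres_rel S R)"
proof (rule equivI)
  show "pres_rel S R \<subseteq> words S \<times> words S" by (auto dest: pres_rel_words)
  show "refl_on (words S) (pres_rel S R)" by (auto intro: refl_onI pres_rel.refl)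
  show "sym (pres_rel S R)" by (rule symI) (rule pres_rel.sym)
  show "trans (pres_rel S R)" by (rule transI) (rule pres_rel.trans)
qed

lemma presented_mult:
  assumes "v \<in> words S" "w \<in> words S"
  shows "pres_rel S R `` {v} \<otimes>\<^bsub>presented_group S R\<^esub> pres_rel S R `` {w} = pres_rel S R `` {v @ w}"
proof -
  have "pres_rel S R `` {a @ b} = pres_rel S R `` {v @ w}"
    if "a \<in> pres_rel S R `` {v}" "b \<in> pres_rel S R `` {w}" for a b
    using equiv_class_eq[OF equiv_pres_rel pres_rel.append[of v a S R w b]] that by simp
  moreover have "v \<in> pres_rel S R `` {v}" "w \<in> pres_rel S R `` {w}"
    using assms by (auto intro: pres_rel.refl)
  ultimately show ?thesis unfolding presented_group_def monoid.simps by (rule UN_UN_const)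
qed

lemma word_inverse:
  "w \<in> words S \<Longrightarrow> (rev (map (\<lambda>(s, b). (s, \<not> b)) w) @ w, []) \<in> pres_rel S R"
proof (induction w)
  case Nil
  then show ?case by (auto simp: words_def intro: pres_rel.refl)
next
  case (Cons a w)
  obtain s b where a: "a = (s, b)" by fastforce
  let ?v = "rev (map (\<lambda>(s, b). (s, \<not> b)) w)"
  have s: "s \<in> S" and w: "w \<in> words S" using Cons.prems by (auto simp: a words_def)
  have v: "?v \<in> words S" using w by (auto simp: words_def)
  have "([(s, \<not> b), (s, b)], []) \<in> pres_rel S R"
    using pres_rel.cancel[OF s, of "\<not> b"] by simp
  from pres_rel.append[OF this pres_rel.refl[OF w]]
  have "([(s, \<not> b), (s, b)] @ w, w) \<in> pres_rel S R" by simp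
  from pres_rel.append[OF pres_rel.refl[OF v] this]
  show ?case using Cons.IH[OF w] by (auto simp: a intro: pres_rel.trans)
qed

lemma group_presented_group: "group (presented_group S R)"
proof (rule groupI)
  let ?P = "presented_group S R"
  have carrI: "pres_rel S R `` {w} \<in> carrier ?P" if "w \<in> words S" for w
    using that by (auto simp: presented_group_def quotient_def)
  have carrE: "\<exists>w\<in>words S. x = pres_rel S R `` {w}" if "x \<in> carrier ?P" for x
    using that by (auto simp: presented_group_def quotient_def)
  have one: "\<one>\<^bsub>?P\<^esub> = pres_rel S R `` {[]}" by (simp add: presented_group_def)
  have app: "v @ w \<in> words S" if "v \<in> words S" "w \<in> words S" for v w :: "'a word"
    using that by (simp add: words_def)
  have nil: "[] \<in> words S" by (simp add: words_def)
  show "\<one>\<^bsub>?P\<^esub> \<in> carrier ?P" using carrI[OF nil] by (simp add: one)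
  show "x \<otimes>\<^bsub>?P\<^esub> y \<in> carrier ?P" if x: "x \<in> carrier ?P" and y: "y \<in> carrier ?P" for x y
    using carrE[OF x] carrE[OF y] by (auto simp: presented_mult intro!: carrI app)
  show "x \<otimes>\<^bsub>?P\<^esub> y \<otimes>\<^bsub>?P\<^esub> z = x \<otimes>\<^bsub>?P\<^esub> (y \<otimes>\<^bsub>?P\<^esub> z)"
    if x: "x \<in> carrier ?P" and y: "y \<in> carrier ?P" and z: "z \<in> carrier ?P" for x y z
    using carrE[OF x] carrE[OF y] carrE[OF z] by (auto simp: presented_mult app)
  show "\<one>\<^bsub>?P\<^esub> \<otimes>\<^bsub>?P\<^esub> x = x" if x: "x \<in> carrier ?P" for x
    using carrE[OF x] by (auto simp: presented_mult nil one)
  show "\<exists>y\<in>carrier ?P. y \<otimes>\<^bsub>?P\<^esub> x = \<one>\<^bsub>?P\<^esub>" if x: "x \<in> carrier ?P" for x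
  proof -
    obtain w where w: "x = pres_rel S R `` {w}" "w \<in> words S" using carrE[OF x] by auto
    let ?v = "rev (map (\<lambda>(s, b). (s, \<not> b)) w)"
    have v: "?v \<in> words S" using w(2) by (auto simp: words_def)
    have "pres_rel S R `` {?v @ w} = pres_rel S R `` {[]}"
      by (rule equiv_class_eq[OF equiv_pres_rel word_inverse[OF w(2)]])
    then have "pres_rel S R `` {?v} \<otimes>\<^bsub>?P\<^esub> x = \<one>\<^bsub>?P\<^esub>"
      by (simp add: w(1) one presented_mult[OF v w(2)])
    then show ?thesis using carrI[OF v] by blast
  qed
qed

subsection \<open>The canonical homomorphism\<close>

definition subgroup_amalgam :: "('a, 'm) monoid_scheme \<Rightarrow> ('j, 'a) amalgam \<Rightarrow> bool" where
  "subgroup_amalgam H A \<longleftrightarrow>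
     (\<forall>j\<in>index A. subgroup (carrier (grp A j)) H \<and> mult (grp A j) = mult H) \<and>
     (\<forall>(i, j)\<in>arrows A. i \<in> index A \<and> j \<in> index A \<and>
        carrier (grp A i) \<subseteq> carrier (grp A j) \<and> (\<forall>x\<in>carrier (grp A i). amap A i j x = x))"

context
  fixes H :: "('a, 'm) monoid_scheme" and A :: "('j, 'a) amalgam"
  assumes H: "group H" and A: "subgroup_amalgam H A"
begin

interpretation H: group H by (rule H)

lemma gens_carrier: "(j, g) \<in> amalgam_gens A \<Longrightarrow> g \<in> carrier H"
  using A by (auto simp: amalgam_gens_def subgroup_amalgam_def dest: subgroup.subset)

lemma word_value_Cons:
  "word_value H (((j, g), b) # w) = (if b then g else inv\<^bsub>H\<^esub> g) \<otimes>\<^bsub>H\<^esub> word_value H w"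
  by (simp add: word_value_def)

lemma word_value_closed: "w \<in> words (amalgam_gens A) \<Longrightarrow> word_value H w \<in> carrier H"
proof (induction w)
  case Nil
  then show ?case by (simp add: word_value_def)
next
  case (Cons a w)
  obtain j g b where a: "a = ((j, g), b)" by (cases a) auto
  have "g \<in> carrier H" "w \<in> words (amalgam_gens A)"
    using Cons.prems gens_carrier by (auto simp: a words_def)
  then show ?case using Cons.IH by (simp add: a word_value_Cons)
qed

lemma word_value_append:
  "v \<in> words (amalgam_gens A) \<Longrightarrow> w \<in> words (amalgam_gens A) \<Longrightarrow>
   word_value H (v @ w) = word_value H v \<otimes>\<^bsub>H\<^esub> word_value H w"
proof (induction v)
  case Nil
  then show ?case using word_value_closed[of w] by (simp add: word_value_def)
next
  case (Cons a v)
  obtain j g b where a: "a = ((j, g), b)" by (cases a) auto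
  have "g \<in> carrier H" "v \<in> words (amalgam_gens A)"
    using Cons.prems(1) gens_carrier by (auto simp: a words_def)
  then show ?case
    using Cons.IH Cons.prems(2) word_value_closed by (simp add: a word_value_Cons H.m_assoc)
qed

lemma word_value_pres_rel:
  "(v, w) \<in> pres_rel (amalgam_gens A) (amalgam_rels A) \<Longrightarrow> word_value H v = word_value H w"
proof (induction rule: pres_rel.induct)
  case (append v v' w w')
  then show ?case by (simp add: word_value_append pres_rel_words)
next
  case (cancel s b)
  then show ?case by (cases s) (auto simp: word_value_def gens_carrier)
next
  case (relator v w)
  from relator(1) consider
    j x y where "v = [((j, x), True), ((j, y), True)]" "w = [((j, x \<otimes>\<^bsub>grp A j\<^esub> y), True)]"
      "j \<in> index A" "x \<in> carrier (grp A j)" "y \<in> carrier (grp A j)"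
  | i j x where "v = [((i, x), True)]" "w = [((j, amap A i j x), True)]"
      "(i, j) \<in> arrows A" "x \<in> carrier (grp A i)"
    unfolding amalgam_rels_def by blast
  then show ?case
  proof cases
    case 1
    then have "x \<in> carrier H" "y \<in> carrier H" "x \<otimes>\<^bsub>grp A j\<^esub> y = x \<otimes>\<^bsub>H\<^esub> y"
      using A by (auto simp: subgroup_amalgam_def dest: subgroup.subset)
    then show ?thesis using 1 by (simp add: word_value_def)
  next
    case 2
    then have "amap A i j x = x" using A by (auto simp: subgroup_amalgam_def)
    then show ?thesis using 2 by (simp add: word_value_def)
  qed
qed auto

lemma canonical_hom_class:
  assumes "w \<in> words (amalgam_gens A)"
  shows "canonical_hom H (pres_rel (amalgam_gens A) (amalgam_rels A) `` {w}) = word_value H w"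
proof -
  have "word_value H ` (pres_rel (amalgam_gens A) (amalgam_rels A) `` {w}) = {word_value H w}"
    using pres_rel.refl[OF assms] word_value_pres_rel[of w] by (auto intro!: image_eqI) 
  then show ?thesis by (simp add: canonical_hom_def)
qed

lemma canonical_hom_generator:
  assumes "j \<in> index A" "g \<in> carrier (grp A j)"
  shows "canonical_hom H (pres_rel (amalgam_gens A) (amalgam_rels A) `` {[((j, g), True)]}) = g"
proof -
  have "(j, g) \<in> amalgam_gens A" using assms by (simp add: amalgam_gens_def)
  then show ?thesis
    by (subst canonical_hom_class) (auto simp: words_def word_value_def gens_carrier)
qed

lemma canonical_hom_in_hom: "canonical_hom H \<in> hom (universal_completion A) H"
proof (rule homI)
  let ?U = "universal_completion A" and ?r = "pres_rel (amalgam_gens A) (amalgam_rels A)"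
  have carrE: "\<exists>w\<in>words (amalgam_gens A). x = ?r `` {w}" if "x \<in> carrier ?U" for x
    using that by (auto simp: universal_completion_def presented_group_def quotient_def)
  show "canonical_hom H x \<in> carrier H" if "x \<in> carrier ?U" for x
    using carrE[OF that] by (auto simp: canonical_hom_class word_value_closed)
  show "canonical_hom H (x \<otimes>\<^bsub>?U\<^esub> y) = canonical_hom H x \<otimes>\<^bsub>H\<^esub> canonical_hom H y"
    if x: "x \<in> carrier ?U" and y: "y \<in> carrier ?U" for x y
  proof -
    obtain v w where vw: "v \<in> words (amalgam_gens A)" "x = ?r `` {v}"
      "w \<in> words (amalgam_gens A)" "y = ?r `` {w}"
      using carrE[OF x] carrE[OF y] by blast
    have "v @ w \<in> words (amalgam_gens A)" using vw by (simp add: words_def)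
    then show ?thesis using vw
      by (simp add: universal_completion_def presented_mult canonical_hom_class word_value_append)
  qed
qed

end

lemma group_aut_subgroup:
  assumes "subgroup G (aut_group \<Gamma>)"
  shows "group (aut_subgroup \<Gamma> G)"
  using assms group_aut_group by (rule subgroup.subgroup_is_group)

lemma subgroup_parabolic:
  assumes G: "subgroup G (aut_group \<Gamma>)" and U: "U \<subseteq> elts \<Gamma>"
  shows "subgroup (parabolic G U) (aut_subgroup \<Gamma> G)"
proof -
  let ?X = "elts \<Gamma>"
  interpret H: group "aut_subgroup \<Gamma> G" by (rule group_aut_subgroup[OF G])
  have sub: "G \<subseteq> geom_auts \<Gamma>" using subgroup.subset[OF G] by (simp add: aut_group_def)
  have B: "g \<in> Bij ?X" if "g \<in> G" for g using that sub by (auto simp: geom_auts_def)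
  have m: "(g \<otimes>\<^bsub>aut_subgroup \<Gamma> G\<^esub> h) x = g (h x)" if "g \<in> G" "h \<in> G" "x \<in> ?X" for g h x
    using B[OF that(1)] B[OF that(2)] that(3)
    by (simp add: aut_group_def BijGroup_def compose_eq)
  have one: "\<one>\<^bsub>aut_subgroup \<Gamma> G\<^esub> x = x" if "x \<in> ?X" for x
    using that by (simp add: aut_group_def BijGroup_def)
  show ?thesis
  proof (rule H.subgroupI)
    show "parabolic G U \<subseteq> carrier (aut_subgroup \<Gamma> G)" by (auto simp: parabolic_def)
    have "\<one>\<^bsub>aut_subgroup \<Gamma> G\<^esub> \<in> parabolic G U"
      using H.one_closed one U by (auto simp: parabolic_def)
    then show "parabolic G U \<noteq> {}" by blast
  next
    fix g assume g: "g \<in> parabolic G U"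
    then have gG: "g \<in> G" by (simp add: parabolic_def)
    let ?i = "inv\<^bsub>aut_subgroup \<Gamma> G\<^esub> g"
    have iG: "?i \<in> G" using H.inv_closed[of g] gG by simp
    have "?i u = u" if u: "u \<in> U" for u
    proof -
      have ux: "u \<in> ?X" using u U by blast
      have "(?i \<otimes>\<^bsub>aut_subgroup \<Gamma> G\<^esub> g) u = u"
        using H.l_inv[of g] gG one[OF ux] by simp
      moreover have "g u = u" using g u by (simp add: parabolic_def)
      ultimately show ?thesis using m[OF iG gG ux] by simp
    qed
    then show "?i \<in> parabolic G U" using iG by (simp add: parabolic_def)
  next
    fix g h assume gh: "g \<in> parabolic G U" "h \<in> parabolic G U"
    then have gG: "g \<in> G" "h \<in> G" by (auto simp: parabolic_def)
    have "g \<otimes>\<^bsub>aut_subgroup \<Gamma> G\<^esub> h \<in> G" using H.m_closed[of g h] gG by simp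
    moreover have "(g \<otimes>\<^bsub>aut_subgroup \<Gamma> G\<^esub> h) u = u" if "u \<in> U" for u
      using m[OF gG, of u] gh that U by (auto simp: parabolic_def)
    ultimately show "g \<otimes>\<^bsub>aut_subgroup \<Gamma> G\<^esub> h \<in> parabolic G U" by (simp add: parabolic_def)
  qed
qed

lemma subgroup_amalgam_parabolic:
  assumes "subgroup G (aut_group \<Gamma>)"
  shows "subgroup_amalgam (aut_subgroup \<Gamma> G) (parabolic_amalgam \<Gamma> G W)"
  using assms subgroup_parabolic[OF assms]
  by (auto simp: subgroup_amalgam_def parabolic_amalgam_def flag_def)
    (auto simp: parabolic_def subset_iff)

lemma subgroup_amalgam_subamalgam:
  "subgroup_amalgam H A \<Longrightarrow> subgroup_amalgam H (subamalgam A J)"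
  by (auto simp: subgroup_amalgam_def subamalgam_def)

subsection \<open>The fundamental group\<close>

lemma cycle_insertion_ends:
  assumes "(u, v) \<in> cycle_insertion \<Gamma>"
  shows "is_path \<Gamma> u" "is_path \<Gamma> v" "hd v = hd u" "last v = last u"
proof -
  obtain p x q c where u: "u = p @ [x] @ q" and v: "v = p @ c @ q"
    and pu: "is_path \<Gamma> (p @ [x] @ q)" and c: "is_cycle \<Gamma> x c"
    using assms by (auto simp: cycle_insertion_def)
  have c': "c \<noteq> []" "hd c = x" "last c = x" "set c \<subseteq> elts \<Gamma>" "successively (inc \<Gamma>) c"
    using c by (auto simp: is_cycle_def is_path_def)
  show "is_path \<Gamma> u" using pu u by simp
  show "is_path \<Gamma> v" using pu c' unfolding v is_path_def
    by (auto simp: successively_append_iff successively_Cons)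
  show "hd v = hd u" using c' by (cases p) (auto simp: u v)
  show "last v = last u" using c' by (cases q rule: rev_cases) (auto simp: u v)
qed

lemma homotopy_ends:
  assumes "(u, v) \<in> homotopy \<Gamma>"
  shows "(is_path \<Gamma> u \<longleftrightarrow> is_path \<Gamma> v) \<and> hd v = hd u \<and> last v = last u"
  using assms unfolding homotopy_def
proof (induction rule: rtrancl_induct)
  case (step y z)
  then show ?case using cycle_insertion_ends[of y z \<Gamma>] cycle_insertion_ends[of z y \<Gamma>] by auto
qed simp

lemma equiv_homotopy: "equiv UNIV (homotopy \<Gamma>)"
proof (rule equivI)
  show "refl (homotopy \<Gamma>)" unfolding homotopy_def by (rule refl_rtrancl)
  show "sym (homotopy \<Gamma>)" unfolding homotopy_def by (rule sym_rtrancl) (rule sym_Un_converse)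
  show "trans (homotopy \<Gamma>)" unfolding homotopy_def by (rule trans_rtrancl)
qed simp

lemma cycle_insertion_context:
  assumes "(u, v) \<in> cycle_insertion \<Gamma>" "is_path \<Gamma> (p @ u @ q)"
  shows "(p @ u @ q, p @ v @ q) \<in> cycle_insertion \<Gamma>"
proof -
  obtain p' x q' c where u: "u = p' @ [x] @ q'" and v: "v = p' @ c @ q'"
    and c: "is_cycle \<Gamma> x c" "path_length c \<in> {1, 2, 3}"
    using assms(1) by (auto simp: cycle_insertion_def)
  have "p @ u @ q = (p @ p') @ [x] @ (q' @ q)" "p @ v @ q = (p @ p') @ c @ (q' @ q)"
    by (simp_all add: u v)
  then show ?thesis using assms(2) c unfolding cycle_insertion_def mem_Collect_eq
    by (metis (no_types))
qed

lemma is_path_context: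
  assumes "is_path \<Gamma> u" "is_path \<Gamma> v" "hd v = hd u" "last v = last u" "is_path \<Gamma> (p @ u @ q)"
  shows "is_path \<Gamma> (p @ v @ q)"
  using assms by (auto simp: is_path_def successively_append_iff)

lemma homotopy_context:
  assumes "(u, v) \<in> homotopy \<Gamma>" "is_path \<Gamma> u" "is_path \<Gamma> (p @ u @ q)"
  shows "(p @ u @ q, p @ v @ q) \<in> homotopy \<Gamma>"
  using assms(1) unfolding homotopy_def
proof (induction rule: rtrancl_induct)
  case (step y z)
  have "(u, y) \<in> homotopy \<Gamma>" "(u, z) \<in> homotopy \<Gamma>"
    unfolding homotopy_def using step.hyps by (blast intro: rtrancl_into_rtrancl)+
  then have "is_path \<Gamma> (p @ y @ q)" "is_path \<Gamma> (p @ z @ q)"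
    using homotopy_ends[of u y \<Gamma>] homotopy_ends[of u z \<Gamma>] assms(2,3)
      is_path_context[of \<Gamma> u y p q] is_path_context[of \<Gamma> u z p q] by auto
  then have "(p @ y @ q, p @ z @ q) \<in> cycle_insertion \<Gamma> \<union> (cycle_insertion \<Gamma>)\<inverse>"
    using step.hyps(2) cycle_insertion_context[of y z \<Gamma> p q] cycle_insertion_context[of z y \<Gamma> p q]
    by blast
  then show ?case using step.IH by (rule rtrancl_into_rtrancl[rotated])
qed simp

lemma cycle_append:
  assumes "is_cycle \<Gamma> x a" "is_cycle \<Gamma> x b"
  shows "is_cycle \<Gamma> x (a @ tl b)" "a @ tl b = butlast a @ b"
proof -
  have ne: "a \<noteq> []" "b \<noteq> []" "last a = x" "hd b = x"
    using assms by (auto simp: is_cycle_def is_path_def)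
  show e: "a @ tl b = butlast a @ b"
  proof -
    have "a = butlast a @ [x]" using ne by (metis append_butlast_last_id)
    moreover have "b = x # tl b" using ne by (metis list.collapse)
    ultimately show ?thesis by (metis append.assoc append_Cons append_Nil)
  qed
  obtain b' where b: "b = x # b'" using ne by (cases b) auto
  show "is_cycle \<Gamma> x (a @ tl b)"
    using assms unfolding b is_cycle_def is_path_def
    by (auto simp: successively_append_iff successively_Cons split: if_splits)
qed

lemma homotopy_append:
  assumes a: "is_cycle \<Gamma> x a" "(a, a') \<in> homotopy \<Gamma>"
    and b: "is_cycle \<Gamma> x b" "(b, b') \<in> homotopy \<Gamma>"
  shows "(a @ tl b, a' @ tl b') \<in> homotopy \<Gamma>"
proof -
  have a': "is_cycle \<Gamma> x a'" using a homotopy_ends[OF a(2)] by (simp add: is_cycle_def)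
  have b': "is_cycle \<Gamma> x b'" using b homotopy_ends[OF b(2)] by (simp add: is_cycle_def)
  have "([] @ a @ tl b, [] @ a' @ tl b) \<in> homotopy \<Gamma>"
    using homotopy_context[OF a(2), of "[]" "tl b"] cycle_append(1)[OF a(1) b(1)] a(1)
    by (simp add: is_cycle_def)
  moreover have "(butlast a' @ b @ [], butlast a' @ b' @ []) \<in> homotopy \<Gamma>"
    using homotopy_context[OF b(2), of "butlast a'" "[]"] cycle_append[OF a' b(1)] b(1)
    by (simp add: is_cycle_def)
  ultimately show ?thesis
    using cycle_append(2)[OF a' b(1)] cycle_append(2)[OF a' b'] equiv_homotopy[of \<Gamma>]
    by (auto simp: equiv_def elim: transE)
qed

lemma homotopy_reverse:
  assumes "symp_on (elts \<Gamma>) (inc \<Gamma>)"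
  shows "is_path \<Gamma> p \<Longrightarrow>
    is_path \<Gamma> (rev p @ tl p) \<and> (rev p @ tl p, [last p]) \<in> homotopy \<Gamma>"
proof (induction p rule: rev_induct)
  case Nil
  then show ?case by (simp add: is_path_def)
next
  case (snoc y p)
  show ?case
  proof (cases "p = []")
    case True
    then show ?thesis using snoc.prems by (simp add: homotopy_def)
  next
    case False
    let ?x = "last p" and ?c = "rev p @ tl p"
    note ne = False
    have p: "is_path \<Gamma> p" and xy: "?x \<in> elts \<Gamma>" "y \<in> elts \<Gamma>" "inc \<Gamma> ?x y"
      using snoc ne by (auto simp: is_path_def successively_append_iff)
    have yx: "inc \<Gamma> y ?x" using assms xy by (auto dest: symp_onD)
    note IH = snoc.IH[OF p]
    have ends: "hd ?c = ?x" "last ?c = ?x"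
      using ne homotopy_ends[OF conjunct2[OF IH]] by (auto simp: hd_rev)
    have "is_path \<Gamma> ([y] @ c @ [y])" if "is_path \<Gamma> c" "hd c = ?x" "last c = ?x" for c
      using that xy yx by (auto simp: is_path_def successively_append_iff successively_Cons)
    from this[OF conjunct1[OF IH] ends] have path: "is_path \<Gamma> ([y] @ ?c @ [y])" .
    have "([y] @ ?c @ [y], [y] @ [?x] @ [y]) \<in> homotopy \<Gamma>"
      using homotopy_context[OF conjunct2[OF IH] conjunct1[OF IH] path] .
    moreover have "([] @ [y] @ [], [] @ [y, ?x, y] @ []) \<in> cycle_insertion \<Gamma>"
      unfolding cycle_insertion_def using xy yx
      by (intro CollectI exI conjI) (auto simp: is_cycle_def is_path_def path_length_def)
    then have "([y, ?x, y], [y]) \<in> homotopy \<Gamma>" by (auto simp: homotopy_def)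
    ultimately have "([y] @ ?c @ [y], [y]) \<in> homotopy \<Gamma>"
      using equiv_homotopy[of \<Gamma>] by (auto simp: equiv_def elim: transE)
    moreover have "rev (p @ [y]) @ tl (p @ [y]) = [y] @ ?c @ [y]" using ne by simp
    ultimately show ?thesis using path by simp
  qed
qed

lemma fundamental_mult:
  assumes "is_cycle \<Gamma> x a" "is_cycle \<Gamma> x b"
  shows "homotopy \<Gamma> `` {a} \<otimes>\<^bsub>fundamental_group \<Gamma> x\<^esub> homotopy \<Gamma> `` {b} = homotopy \<Gamma> `` {a @ tl b}"
proof -
  have "homotopy \<Gamma> `` {a' @ tl b'} = homotopy \<Gamma> `` {a @ tl b}"
    if "a' \<in> homotopy \<Gamma> `` {a}" "b' \<in> homotopy \<Gamma> `` {b}" for a' b'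
    using equiv_class_eq[OF equiv_homotopy homotopy_append[OF assms(1) _ assms(2), of a' b']] that
    by simp
  moreover have "a \<in> homotopy \<Gamma> `` {a}" "b \<in> homotopy \<Gamma> `` {b}" by (auto simp: homotopy_def)
  ultimately show ?thesis unfolding fundamental_group_def monoid.simps by (rule UN_UN_const)
qed

lemma group_fundamental_group:
  assumes \<Gamma>: "pregeometry \<Gamma>" and x: "x \<in> elts \<Gamma>"
  shows "group (fundamental_group \<Gamma> x)"
proof (rule groupI)
  let ?P = "fundamental_group \<Gamma> x" and ?h = "\<lambda>p. homotopy \<Gamma> `` {p}"
  have carrI: "?h p \<in> carrier ?P" if "is_cycle \<Gamma> x p" for p
    using that by (auto simp: fundamental_group_def quotient_def)
  have carrE: "\<exists>p. is_cycle \<Gamma> x p \<and> A = ?h p" if "A \<in> carrier ?P" for A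
    using that by (auto simp: fundamental_group_def quotient_def)
  have one: "\<one>\<^bsub>?P\<^esub> = ?h [x]" by (simp add: fundamental_group_def)
  have triv: "is_cycle \<Gamma> x [x]" using x by (simp add: is_cycle_def is_path_def)
  show "\<one>\<^bsub>?P\<^esub> \<in> carrier ?P" using carrI[OF triv] by (simp add: one)
  show "A \<otimes>\<^bsub>?P\<^esub> B \<in> carrier ?P" if A: "A \<in> carrier ?P" and B: "B \<in> carrier ?P" for A B
    using carrE[OF A] carrE[OF B] by (auto simp: fundamental_mult cycle_append intro!: carrI)
      (metis cycle_append)
  show "A \<otimes>\<^bsub>?P\<^esub> B \<otimes>\<^bsub>?P\<^esub> C = A \<otimes>\<^bsub>?P\<^esub> (B \<otimes>\<^bsub>?P\<^esub> C)"
    if A: "A \<in> carrier ?P" and B: "B \<in> carrier ?P" and C: "C \<in> carrier ?P" for A B C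
  proof -
    obtain a b c where abc: "is_cycle \<Gamma> x a" "A = ?h a" "is_cycle \<Gamma> x b" "B = ?h b"
      "is_cycle \<Gamma> x c" "C = ?h c"
      using carrE[OF A] carrE[OF B] carrE[OF C] by blast
    have "b \<noteq> []" using abc by (simp add: is_cycle_def is_path_def)
    then show ?thesis
      using abc cycle_append(1)[OF abc(1,3)] cycle_append(1)[OF abc(3,5)]
      by (simp add: fundamental_mult)
  qed
  show "\<one>\<^bsub>?P\<^esub> \<otimes>\<^bsub>?P\<^esub> A = A" if A: "A \<in> carrier ?P" for A
  proof -
    obtain a where a: "is_cycle \<Gamma> x a" "A = ?h a" using carrE[OF A] by blast
    then show ?thesis using cycle_append(2)[OF triv a(1)] by (simp add: one fundamental_mult[OF triv])
  qed
  show "\<exists>B\<in>carrier ?P. B \<otimes>\<^bsub>?P\<^esub> A = \<one>\<^bsub>?P\<^esub>" if A: "A \<in> carrier ?P" for A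
  proof -
    obtain a where a: "is_cycle \<Gamma> x a" "A = ?h a" using carrE[OF A] by blast
    have s: "symp_on (elts \<Gamma>) (inc \<Gamma>)" using \<Gamma> by (simp add: pregeometry_def)
    have r: "is_path \<Gamma> (rev a @ tl a)" "(rev a @ tl a, [x]) \<in> homotopy \<Gamma>"
      using homotopy_reverse[OF s, of a] a by (auto simp: is_cycle_def)
    then have "is_cycle \<Gamma> x (rev a)"
      using a(1) by (auto simp: is_cycle_def is_path_def successively_append_iff hd_rev last_rev)
    moreover have "?h (rev a @ tl a) = ?h [x]"
      by (rule equiv_class_eq[OF equiv_homotopy r(2)])
    ultimately show ?thesis
      using carrI[of "rev a"] a by (metis fundamental_mult one)
  qed
qed

end

theory Submission
  imports Defs
begin

text \<open>
  The theorem is a version of Tits' lemma for actions with several orbits of elements of each type.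
  The canonical homomorphism from a universal completion \<open>K\<close> to \<open>G\<close> is onto as soon as the parabolics
  generate \<open>G\<close>, and it is injective as soon as it has a left inverse, that is, as soon as the
  tautological maps \<open>G\<^sub>U \<rightarrow> K\<close> are the restrictions of one homomorphism \<open>G \<rightarrow> K\<close>. Both are proved for
  all \<open>G\<^sub>U\<close> by descending induction on the size of the flag \<open>U \<subseteq> W\<close>, starting at the flags that
  occur in the amalgam and ending at \<open>U = {}\<close>, where \<open>G\<^sub>U = G\<close>. The residues of the flags that are
  met in between have rank at least \<open>k\<close>.

  The induction step concerns \<open>H = G\<^sub>U\<close> acting on the residue of \<open>U\<close>. Every flag of \<open>\<Gamma>\<close> is carried into
  \<open>W\<close> by an element of \<open>G\<close> (lemma \<open>flag_conjugate_to_reps\<close>); applied to flags \<open>U \<union> {x, y, z}\<close> this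
  says that \<open>H\<close> moves pairwise incident elements of the residue simultaneously to their orbit
  representatives in \<open>W\<close>. If homomorphisms \<open>\<phi>\<^sub>w\<close> to a group \<open>K\<close> are given on the stabilizers \<open>H\<^sub>w\<close> of
  the representatives, and \<open>\<phi>\<^sub>v = \<phi>\<^sub>w\<close> on \<open>H\<^sub>v \<inter> H\<^sub>w\<close> for incident \<open>v, w\<close>, then a common
  extension to \<open>H\<close> is the same thing as a map \<open>F\<close> on \<open>H\<close> with \<open>F (h u) = F h * \<phi>\<^sub>w u\<close> for all \<open>w\<close>
  and \<open>u \<in> H\<^sub>w\<close>, normalized by \<open>F 1 = 1\<close>: since the \<open>H\<^sub>w\<close> generate \<open>H\<close> (connectedness of the
  residue, lemma \<open>stabilizers_generate\<close>), such a map is multiplicative.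

  For a single \<open>w\<close> there are many maps with \<open>F (h u) = F h * \<phi>\<^sub>w u\<close>, as the value can be prescribed
  arbitrarily on one element of each coset of \<open>H\<^sub>w\<close>, that is, at each element \<open>x\<close> of the orbit of
  \<open>w\<close>. Choices at two incident elements \<open>x, y\<close> are compared by a transition element \<open>c x y\<close> of \<open>K\<close>,
  and moving a triangle to its representatives shows \<open>c x y * c y z = c x z\<close>. On a simply connected
  pregeometry such a cocycle is a coboundary (lemma \<open>simply_connected_potential\<close>): its product along a
  path depends only on the end points because short cycles contribute nothing. Correcting the choices
  by this coboundary makes the maps for incident representatives equal. In a hall any two
  representatives of different type are incident, so that all these maps are one map \<open>F\<close> (lemma
  \<open>reps_linked\<close>, which includes the case of a single type).
\<close>

section \<open>Cocycles on a simply connected pregeometry\<close>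

lemma null_homotopic_cycle:
  assumes "simply_connected_geom \<Delta>" "is_cycle \<Delta> x p"
  shows "([x], p) \<in> homotopy \<Delta>"
proof -
  have "p \<noteq> []" "set p \<subseteq> elts \<Delta>" "hd p = x"
    using assms(2) by (auto simp: is_cycle_def is_path_def)
  then have "x \<in> elts \<Delta>" by auto
  then have "carrier (fundamental_group \<Delta> x) = {\<one>\<^bsub>fundamental_group \<Delta> x\<^esub>}"
    using assms(1) by (simp add: simply_connected_geom_def trivial_group_def)
  moreover have "homotopy \<Delta> `` {p} \<in> carrier (fundamental_group \<Delta> x)"
    using assms(2) by (auto simp: fundamental_group_def quotient_def)
  ultimately have "homotopy \<Delta> `` {p} = homotopy \<Delta> `` {[x]}"
    by (simp add: fundamental_group_def)
  moreover have "p \<in> homotopy \<Delta> `` {p}" by (auto simp: homotopy_def)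
  ultimately show ?thesis by auto
qed

text \<open>Pairs and triples of pairwise incident elements are the edges and triangles of the complex whose
  edge path group is the fundamental group; a cocycle is a flat labelling of its edges. Taking
  degenerate triangles, the triangle law also yields \<open>c x x = \<one>\<close> and \<open>c x y \<otimes> c y x = \<one>\<close>.\<close>

locale cocycle = group K for K (structure) +
  fixes \<Delta> :: "('x, 'i) pregeom" and c :: "'x \<Rightarrow> 'x \<Rightarrow> 'a"
  assumes inc_refl: "x \<in> elts \<Delta> \<Longrightarrow> inc \<Delta> x x"
    and inc_sym: "\<lbrakk>x \<in> elts \<Delta>; y \<in> elts \<Delta>; inc \<Delta> x y\<rbrakk> \<Longrightarrow> inc \<Delta> y x"
    and closed: "\<lbrakk>x \<in> elts \<Delta>; y \<in> elts \<Delta>; inc \<Delta> x y\<rbrakk> \<Longrightarrow> c x y \<in> carrier K"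
    and triangle: "\<lbrakk>x \<in> elts \<Delta>; y \<in> elts \<Delta>; z \<in> elts \<Delta>; inc \<Delta> x y; inc \<Delta> y z; inc \<Delta> x z\<rbrakk>
       \<Longrightarrow> c x y \<otimes> c y z = c x z"
begin

fun path_prod :: "'x list \<Rightarrow> 'a" where
  "path_prod (x # y # p) = c x y \<otimes> path_prod (y # p)"
| "path_prod _ = \<one>"

lemma path_prod_closed: "is_path \<Delta> p \<Longrightarrow> path_prod p \<in> carrier K"
  by (induction p rule: path_prod.induct) (auto simp: is_path_def closed)

lemma path_prod_join:
  "is_path \<Delta> (p @ x # q) \<Longrightarrow> path_prod (p @ x # q) = path_prod (p @ [x]) \<otimes> path_prod (x # q)"
proof (induction p)
  case Nil
  then show ?case using path_prod_closed by simp
next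
  case (Cons a p)
  obtain y r where "p @ [x] = y # r" by (cases "p @ [x]") auto
  then have e: "p @ [x] = y # r" "p @ x # q = y # r @ q"
    by (simp_all add: append_eq_Cons_conv) auto
  have path: "is_path \<Delta> (p @ x # q)" using Cons.prems by (auto simp: is_path_def successively_Cons)
  have a: "a \<in> elts \<Delta>" "y \<in> elts \<Delta>" "inc \<Delta> a y"
    using Cons.prems unfolding append_Cons e(2) is_path_def by auto
  have "is_path \<Delta> (p @ [x])" "is_path \<Delta> (x # q)"
    using path by (auto simp: is_path_def successively_append_iff)
  then have "path_prod (p @ [x]) \<in> carrier K" "path_prod (x # q) \<in> carrier K"
    by (auto intro: path_prod_closed)
  moreover have "path_prod (a # p @ [x]) = c a y \<otimes> path_prod (p @ [x])"
    by (simp add: e(1))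
  moreover have "path_prod (a # p @ x # q) = c a y \<otimes> path_prod (p @ x # q)"
    by (simp add: e(2))
  ultimately show ?case using Cons.IH[OF path] closed[OF a] by (simp add: m_assoc)
qed

lemma cocycle_refl: "x \<in> elts \<Delta> \<Longrightarrow> c x x = \<one>"
  using triangle[of x x x] closed[of x x] inc_refl[of x] r_cancel_one by blast

lemma cocycle_sym: "\<lbrakk>x \<in> elts \<Delta>; y \<in> elts \<Delta>; inc \<Delta> x y\<rbrakk> \<Longrightarrow> c x y \<otimes> c y x = \<one>"
  using triangle[of x y x] inc_refl[of x] inc_sym[of x y] cocycle_refl by simp

lemma path_prod_short_cycle:
  assumes "is_cycle \<Delta> x p" "path_length p \<in> {1, 2, 3}"
  shows "path_prod p = \<one>"
proof -
  have p: "p \<noteq> []" "set p \<subseteq> elts \<Delta>" "successively (inc \<Delta>) p" "hd p = x" "last p = x"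
    using assms(1) by (auto simp: is_cycle_def is_path_def)
  then obtain q where q: "p = x # q" by (cases p) auto
  then have "length q \<in> {1, 2, 3}" using assms(2) by (simp add: path_length_def)
  then consider "p = [x, x]" | y where "p = [x, y, x]" | y z where "p = [x, y, z, x]"
    using p(5) unfolding q by (auto simp: length_Suc_conv numeral_eq_Suc split: if_splits)
  then show ?thesis
  proof cases
    case 1
    then show ?thesis using p cocycle_refl by simp
  next
    case 2
    then show ?thesis using p cocycle_sym closed by auto
  next
    case (3 y z)
    then have e: "x \<in> elts \<Delta>" "y \<in> elts \<Delta>" "z \<in> elts \<Delta>"
        "inc \<Delta> x y" "inc \<Delta> y z" "inc \<Delta> z x" using p by auto
    have i: "inc \<Delta> x z" using e inc_sym by blast
    have "path_prod p = c x y \<otimes> c y z \<otimes> c z x"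
      using 3 e closed by (simp add: m_assoc)
    also have "\<dots> = \<one>" using triangle[OF e(1-5) i] cocycle_sym[OF e(1,3) i] by simp
    finally show ?thesis .
  qed
qed

text \<open>The product along the path factors at the place of insertion, and the inserted cycle
  contributes a trivial factor.\<close>

lemma path_prod_insertion:
  assumes "(u, v) \<in> cycle_insertion \<Delta>"
  shows "path_prod u = path_prod v"
proof -
  obtain p x q d where u: "u = p @ [x] @ q" and v: "v = p @ d @ q"
    and d: "is_cycle \<Delta> x d" "path_length d \<in> {1, 2, 3}"
    using assms by (auto simp: cycle_insertion_def)
  have pu: "is_path \<Delta> u" and pv: "is_path \<Delta> v" using cycle_insertion_ends[OF assms] by auto
  have dne: "d \<noteq> []" "hd d = x" "last d = x" using d(1) by (auto simp: is_cycle_def is_path_def)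
  obtain d' where d': "d = x # d'" using dne by (cases d) auto
  have d'': "d = butlast d @ [x]" using dne by (metis append_butlast_last_id)
  have dx: "is_path \<Delta> (d @ q)" "is_path \<Delta> (p @ [x])" "is_path \<Delta> (x # q)"
    using pu pv dne unfolding u v is_path_def by (auto simp: successively_append_iff)
  have "path_prod v = path_prod (p @ [x]) \<otimes> path_prod (d @ q)"
    using path_prod_join[of p x "d' @ q"] pv by (simp add: v d')
  also have "path_prod (d @ q) = path_prod d \<otimes> path_prod (x # q)"
    using path_prod_join[of "butlast d" x q] dx(1) d''
    by (metis append.assoc append_Cons append_Nil)
  also have "\<dots> = path_prod (x # q)"
    using path_prod_short_cycle[OF d] path_prod_closed[OF dx(3)] by simp
  also have "path_prod (p @ [x]) \<otimes> path_prod (x # q) = path_prod u"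
    using path_prod_join[of p x q] pu by (simp add: u)
  finally show ?thesis by simp
qed

lemma path_prod_homotopy: "(u, v) \<in> homotopy \<Delta> \<Longrightarrow> path_prod u = path_prod v"
  unfolding homotopy_def
  by (induction rule: rtrancl_induct) (auto dest: path_prod_insertion)

lemma path_prod_rev: "is_path \<Delta> p \<Longrightarrow> is_path \<Delta> (rev p) \<and> path_prod p \<otimes> path_prod (rev p) = \<one>"
proof (induction p rule: path_prod.induct)
  case (1 x y p)
  let ?q = "y # p"
  have xy: "x \<in> elts \<Delta>" "y \<in> elts \<Delta>" "inc \<Delta> x y" and q: "is_path \<Delta> ?q"
    using "1.prems" by (auto simp: is_path_def)
  note yx = inc_sym[OF xy]
  note IH = "1.IH"[OF q]
  have path: "is_path \<Delta> (rev p @ y # [x])"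
    using IH xy yx by (auto simp: is_path_def successively_append_iff successively_Cons)
  have cl: "c x y \<in> carrier K" "c y x \<in> carrier K" "path_prod ?q \<in> carrier K"
      "path_prod (rev ?q) \<in> carrier K"
    using closed[OF xy] closed[OF xy(2,1) yx] path_prod_closed[OF q] IH path_prod_closed by auto
  have "path_prod (rev (x # ?q)) = path_prod (rev ?q) \<otimes> c y x"
    using path_prod_join[OF path] cl by simp
  then have "path_prod (x # ?q) \<otimes> path_prod (rev (x # ?q))
      = c x y \<otimes> path_prod ?q \<otimes> (path_prod (rev ?q) \<otimes> c y x)" by simp
  also have "\<dots> = c x y \<otimes> (path_prod ?q \<otimes> path_prod (rev ?q)) \<otimes> c y x"
    using cl by (simp only: m_assoc m_closed)
  also have "\<dots> = \<one>" using IH cl cocycle_sym[OF xy] by simp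
  finally show ?case using path by simp
qed (auto simp: is_path_def)

text \<open>The potential of \<open>x\<close> is the product along some path from a base point to \<open>x\<close>. It satisfies the
  equation on \<open>x\<close> and \<open>y\<close> because the path to \<open>x\<close>, the step to \<open>y\<close> and the reverse of the path to \<open>y\<close>
  together form a null-homotopic cycle.\<close>

lemma simply_connected_potential:
  assumes sc: "simply_connected_geom \<Delta>"
  obtains f where "\<And>x. x \<in> elts \<Delta> \<Longrightarrow> f x \<in> carrier K"
    "\<And>x y. \<lbrakk>x \<in> elts \<Delta>; y \<in> elts \<Delta>; inc \<Delta> x y\<rbrakk> \<Longrightarrow> f y = f x \<otimes> c x y"
proof (cases "elts \<Delta> = {}")
  case True
  then show ?thesis using that by blast
next
  case False
  then obtain b where b: "b \<in> elts \<Delta>" by blast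
  define p where "p x = (SOME p. is_path \<Delta> p \<and> hd p = b \<and> last p = x)" for x
  have p: "is_path \<Delta> (p x) \<and> hd (p x) = b \<and> last (p x) = x" if "x \<in> elts \<Delta>" for x
  proof -
    have "\<exists>p. is_path \<Delta> p \<and> hd p = b \<and> last p = x"
      using sc b that by (simp add: simply_connected_geom_def connected_geom_def)
    then show ?thesis unfolding p_def by (rule someI_ex)
  qed
  show ?thesis
  proof (rule that[of "\<lambda>x. path_prod (p x)"])
    show "path_prod (p x) \<in> carrier K" if "x \<in> elts \<Delta>" for x
      using p[OF that] path_prod_closed by blast
  next
    fix x y assume xy: "x \<in> elts \<Delta>" "y \<in> elts \<Delta>" "inc \<Delta> x y"
    have px: "is_path \<Delta> (p x)" "p x \<noteq> []" "last (p x) = x" "hd (p x) = b"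
      and py: "is_path \<Delta> (p y)" "p y \<noteq> []" "last (p y) = y" "hd (p y) = b"
      using p[OF xy(1)] p[OF xy(2)] by (auto simp: is_path_def)
    define r where "r = rev (butlast (p y))"
    have rev: "rev (p y) = y # r"
      using py unfolding r_def by (metis append_butlast_last_id rev_eq_Cons_iff rev_rev_ident)
    have rpath: "is_path \<Delta> (y # r)" "path_prod (p y) \<otimes> path_prod (y # r) = \<one>"
      using path_prod_rev[OF py(1)] by (simp_all add: rev)
    have pxy: "is_path \<Delta> (p x @ y # r)" "is_path \<Delta> (p x @ [y])"
      using px rpath xy by (auto simp: is_path_def successively_append_iff)
    have "last (y # r) = b" using rev py by (metis last_rev)
    then have "is_cycle \<Delta> b (p x @ y # r)" using pxy px by (simp add: is_cycle_def)
    then have "path_prod (p x @ y # r) = \<one>"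
      using null_homotopic_cycle[OF sc] path_prod_homotopy by fastforce
    then have "path_prod (p x @ [y]) \<otimes> path_prod (y # r) = \<one>"
      using path_prod_join[OF pxy(1)] by simp
    then have "path_prod (p x @ [y]) = path_prod (p y)"
      using rpath(2) right_cancel[OF path_prod_closed[OF rpath(1)] path_prod_closed[OF pxy(2)]
        path_prod_closed[OF py(1)]] by simp
    moreover have "p x @ [y] = butlast (p x) @ x # [y]"
      using px by (metis append.assoc append_Cons append_Nil append_butlast_last_id)
    moreover have "path_prod (butlast (p x) @ x # [y]) = path_prod (p x) \<otimes> path_prod [x, y]"
      using path_prod_join[of "butlast (p x)" x "[y]"] pxy(2) calculation(2) px
      by (metis append_butlast_last_id)
    ultimately show "path_prod (p y) = path_prod (p x) \<otimes> c x y" using closed[OF xy] by simp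
  qed
qed

end

section \<open>Tits' lemma for the stabilizers of orbit representatives\<close>

text \<open>The properties of \<open>H = G\<^sub>U\<close> acting on the residue of \<open>U\<close> on which Tits' lemma rests, where
  \<open>rep x\<close> is the element of the hall in the orbit of \<open>x\<close>. The assumption \<open>rep_inc\<close> is what remains
  of the hall axiom, and \<open>transitive\<close> is flag-transitivity for flags of at most three elements.\<close>

locale hall_action = group H for H (structure) +
  fixes \<Delta> :: "('x, 'i) pregeom" and act :: "'a \<Rightarrow> 'x \<Rightarrow> 'x" and rep :: "'x \<Rightarrow> 'x"
  assumes inc_refl: "x \<in> elts \<Delta> \<Longrightarrow> inc \<Delta> x x"
    and inc_sym: "\<lbrakk>x \<in> elts \<Delta>; y \<in> elts \<Delta>; inc \<Delta> x y\<rbrakk> \<Longrightarrow> inc \<Delta> y x"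
    and inc_ty: "\<lbrakk>x \<in> elts \<Delta>; y \<in> elts \<Delta>; inc \<Delta> x y; ty \<Delta> x = ty \<Delta> y\<rbrakk> \<Longrightarrow> x = y"
    and act_closed: "\<lbrakk>h \<in> carrier H; x \<in> elts \<Delta>\<rbrakk> \<Longrightarrow> act h x \<in> elts \<Delta>"
    and act_mult: "\<lbrakk>g \<in> carrier H; h \<in> carrier H; x \<in> elts \<Delta>\<rbrakk> \<Longrightarrow> act (g \<otimes> h) x = act g (act h x)"
    and act_one: "x \<in> elts \<Delta> \<Longrightarrow> act \<one> x = x"
    and act_inc: "\<lbrakk>h \<in> carrier H; x \<in> elts \<Delta>; y \<in> elts \<Delta>; inc \<Delta> x y\<rbrakk>
       \<Longrightarrow> inc \<Delta> (act h x) (act h y)"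
    and rep_closed: "x \<in> elts \<Delta> \<Longrightarrow> rep x \<in> elts \<Delta>"
    and rep_rep: "x \<in> elts \<Delta> \<Longrightarrow> rep (rep x) = rep x"
    and rep_act: "\<lbrakk>h \<in> carrier H; x \<in> elts \<Delta>\<rbrakk> \<Longrightarrow> rep (act h x) = rep x"
    and rep_ty: "x \<in> elts \<Delta> \<Longrightarrow> ty \<Delta> (rep x) = ty \<Delta> x"
    and rep_inc: "\<lbrakk>x \<in> elts \<Delta>; y \<in> elts \<Delta>; ty \<Delta> x \<noteq> ty \<Delta> y\<rbrakk> \<Longrightarrow> inc \<Delta> (rep x) (rep y)"
    and transitive: "\<lbrakk>x \<in> elts \<Delta>; y \<in> elts \<Delta>; z \<in> elts \<Delta>; inc \<Delta> x y; inc \<Delta> y z; inc \<Delta> x z\<rbrakk>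
       \<Longrightarrow> \<exists>t\<in>carrier H. act t (rep x) = x \<and> act t (rep y) = y \<and> act t (rep z) = z"
begin

definition reps :: "'x set" where
  "reps = {w \<in> elts \<Delta>. rep w = w}"

definition stab :: "'x \<Rightarrow> 'a set" where
  "stab x = {h \<in> carrier H. act h x = x}"

lemma reps_elts: "w \<in> reps \<Longrightarrow> w \<in> elts \<Delta>" and reps_rep: "w \<in> reps \<Longrightarrow> rep w = w"
  by (auto simp: reps_def)

lemma rep_in_reps: "x \<in> elts \<Delta> \<Longrightarrow> rep x \<in> reps"
  by (simp add: reps_def rep_closed rep_rep)

lemma transitive2:
  "\<lbrakk>x \<in> elts \<Delta>; y \<in> elts \<Delta>; inc \<Delta> x y\<rbrakk>
   \<Longrightarrow> \<exists>t\<in>carrier H. act t (rep x) = x \<and> act t (rep y) = y"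
  using transitive[of x y y] inc_refl by blast

lemma act_inv: "\<lbrakk>h \<in> carrier H; x \<in> elts \<Delta>\<rbrakk> \<Longrightarrow> act (inv h) (act h x) = x"
  using act_mult[of "inv h" h x] by (simp add: act_one)

lemma stab_quotient:
  "\<lbrakk>g \<in> carrier H; h \<in> carrier H; x \<in> elts \<Delta>; act g x = act h x\<rbrakk> \<Longrightarrow> inv g \<otimes> h \<in> stab x"
  using act_mult[of "inv g" h x] act_inv[of g x] by (simp add: stab_def)

lemma connected_induct [consumes 3, case_names base step]:
  assumes conn: "connected_geom \<Delta>" and b: "b \<in> elts \<Delta>" and x: "x \<in> elts \<Delta>"
    and base: "P b"
    and step: "\<And>x y. \<lbrakk>x \<in> elts \<Delta>; y \<in> elts \<Delta>; inc \<Delta> x y; P x\<rbrakk> \<Longrightarrow> P y"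
  shows "P x"
proof -
  have "is_path \<Delta> p \<Longrightarrow> hd p = b \<Longrightarrow> P (last p)" for p
  proof (induction p rule: rev_induct)
    case Nil
    then show ?case by (simp add: is_path_def)
  next
    case (snoc y p)
    show ?case
    proof (cases "p = []")
      case True
      then show ?thesis using snoc base by simp
    next
      case False
      then have "is_path \<Delta> p" "hd p = b" "last p \<in> elts \<Delta>" "y \<in> elts \<Delta>" "inc \<Delta> (last p) y"
        using snoc.prems by (auto simp: is_path_def successively_append_iff)
      then show ?thesis using snoc.IH step by auto
    qed
  qed
  moreover obtain p where "is_path \<Delta> p" "hd p = b" "last p = x"
    using conn b x unfolding connected_geom_def by blast
  ultimately show ?thesis by blast
qed

text \<open>If \<open>s\<close> in \<open>S\<close> carries the representative of \<open>x\<close> to \<open>x\<close>, and \<open>t\<close> does so for \<open>x\<close> and a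
  neighbour \<open>y\<close> at once, then \<open>s\<close> and \<open>t\<close> differ by a stabilizer, so that \<open>t\<close> lies in \<open>S\<close> too.
  Hence \<open>S\<close> reaches every element of the connected pregeometry. Now let \<open>h\<close> be arbitrary and \<open>b\<close> a
  representative. Some \<open>s\<close> in \<open>S\<close> has the same value at \<open>b\<close> as \<open>h\<close>, and it differs from \<open>h\<close> by an
  element of the stabilizer of \<open>b\<close>.\<close>

lemma stabilizers_generate:
  assumes conn: "connected_geom \<Delta>" and ne: "elts \<Delta> \<noteq> {}"
    and S: "subgroup S H" and stab: "\<And>w. w \<in> reps \<Longrightarrow> stab w \<subseteq> S"
  shows "carrier H \<subseteq> S"
proof
  fix h assume h: "h \<in> carrier H"
  obtain b where b: "b \<in> reps" using ne rep_in_reps by blast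
  have hb: "act h b \<in> elts \<Delta>" using act_closed h reps_elts[OF b] by blast
  interpret S: subgroup S H by (rule S)
  have reach: "t \<in> S" if "s \<in> S" "t \<in> carrier H" "x \<in> elts \<Delta>" "act s (rep x) = act t (rep x)" for s t x
  proof -
    have "s \<otimes> (inv s \<otimes> t) \<in> S"
      using stab_quotient[of s t "rep x"] stab[OF rep_in_reps] that rep_closed S.subset by auto
    then show ?thesis using that S.subset by (simp add: m_assoc[symmetric] subset_iff)
  qed
  have "\<exists>s\<in>S. act s (rep x) = x" if x: "x \<in> elts \<Delta>" for x
    using conn reps_elts[OF b] x
  proof (induction rule: connected_induct)
    case base
    then show ?case
      using act_one reps_elts[OF b] reps_rep[OF b] by (intro bexI[OF _ S.one_closed]) simp
  next
    case (step x y)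
    then obtain s where s: "s \<in> S" "act s (rep x) = x" by blast
    obtain t where t: "t \<in> carrier H" "act t (rep x) = x" "act t (rep y) = y"
      using transitive2 step by blast
    then show ?case using reach[of s t x] s step by auto
  qed
  then obtain s where "s \<in> S" "act s (rep (act h b)) = act h b" using hb by blast
  then show "h \<in> S"
    using reach[of s h b] h reps_elts[OF b] reps_rep[OF b] rep_act by auto
qed

text \<open>Two representatives of the same type need not be incident, but both are incident with any
  representative of another type. If there is no other type, incidence is equality and connectedness
  leaves only one element.\<close>

lemma reps_linked:
  assumes conn: "connected_geom \<Delta>"
    and P: "\<And>v w. \<lbrakk>v \<in> reps; w \<in> reps; inc \<Delta> v w\<rbrakk> \<Longrightarrow> q v = q w"
    and vw: "v \<in> reps" "w \<in> reps"
  shows "q v = q w"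
proof (cases "\<exists>x\<in>elts \<Delta>. ty \<Delta> x \<noteq> ty \<Delta> v")
  case True
  then obtain x where x: "x \<in> elts \<Delta>" "ty \<Delta> x \<noteq> ty \<Delta> v" by blast
  have diff: "q u = q u'" if "u \<in> reps" "u' \<in> reps" "ty \<Delta> u \<noteq> ty \<Delta> u'" for u u'
    using rep_inc[of u u'] P[of u u'] that by (auto simp: reps_def)
  show ?thesis
  proof (cases "ty \<Delta> v = ty \<Delta> w")
    case True
    then show ?thesis using diff[of v "rep x"] diff[of "rep x" w] x vw rep_in_reps rep_ty by metis
  next
    case False
    then show ?thesis using diff vw by blast
  qed
next
  case False
  have "w = v" using conn reps_elts[OF vw(1)] reps_elts[OF vw(2)]
  proof (induction rule: connected_induct)
    case (step x y)
    then show ?case using False inc_ty by metis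
  qed simp
  then show ?thesis by simp
qed

end

text \<open>The stabilizers of the representatives form an amalgam in which the stabilizers of \<open>v\<close> and \<open>w\<close> are
  glued along their intersection exactly if \<open>v\<close> and \<open>w\<close> are incident; \<open>\<phi>\<close> is a homomorphism from
  this amalgam to \<open>K\<close>.\<close>

locale hall_action_family = hall_action H \<Delta> act rep + K: group K
  for H :: "('a, 'm) monoid_scheme" (structure) and \<Delta> :: "('x, 'i) pregeom"
    and act :: "'a \<Rightarrow> 'x \<Rightarrow> 'x" and rep :: "'x \<Rightarrow> 'x" and K :: "('k, 'n) monoid_scheme" +
  fixes \<phi> :: "'x \<Rightarrow> 'a \<Rightarrow> 'k"
  assumes \<phi>_closed: "\<lbrakk>w \<in> reps; u \<in> stab w\<rbrakk> \<Longrightarrow> \<phi> w u \<in> carrier K"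
    and \<phi>_mult: "\<lbrakk>w \<in> reps; u \<in> stab w; u' \<in> stab w\<rbrakk> \<Longrightarrow> \<phi> w (u \<otimes> u') = \<phi> w u \<otimes>\<^bsub>K\<^esub> \<phi> w u'"
    and \<phi>_compat: "\<lbrakk>v \<in> reps; w \<in> reps; inc \<Delta> v w; u \<in> stab v; u \<in> stab w\<rbrakk> \<Longrightarrow> \<phi> v u = \<phi> w u"
begin

definition section_at :: "'x \<Rightarrow> 'a" where
  "section_at x = (SOME s. s \<in> carrier H \<and> act s (rep x) = x)"

lemma section_at: "x \<in> elts \<Delta> \<Longrightarrow> section_at x \<in> carrier H \<and> act (section_at x) (rep x) = x"
  unfolding section_at_def
  by (rule someI_ex) (use transitive2[of x x] inc_refl[of x] in blast)

text \<open>This is the map with \<open>\<psi> w (h u) = \<psi> w h * \<phi> w u\<close> for \<open>u \<in> stab w\<close> that takes the value \<open>\<one>\<close> at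
  the chosen element \<open>section_at x\<close> of each coset of \<open>stab w\<close>.\<close>

definition \<psi> :: "'x \<Rightarrow> 'a \<Rightarrow> 'k" where
  "\<psi> w h = \<phi> w (inv (section_at (act h w)) \<otimes> h)"

lemma section_stab:
  assumes "w \<in> reps" "h \<in> carrier H"
  shows "inv (section_at (act h w)) \<otimes> h \<in> stab w"
proof -
  have "act h w \<in> elts \<Delta>" "rep (act h w) = w"
    using assms by (auto simp: reps_def act_closed rep_act)
  then show ?thesis using section_at[of "act h w"] assms by (intro stab_quotient) (auto simp: reps_def)
qed

lemma \<psi>_closed: "\<lbrakk>w \<in> reps; h \<in> carrier H\<rbrakk> \<Longrightarrow> \<psi> w h \<in> carrier K"
  unfolding \<psi>_def by (intro \<phi>_closed section_stab)

lemma \<psi>_mult_stab: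
  assumes "w \<in> reps" "h \<in> carrier H" "u \<in> stab w"
  shows "\<psi> w (h \<otimes> u) = \<psi> w h \<otimes>\<^bsub>K\<^esub> \<phi> w u"
proof -
  have u: "u \<in> carrier H" "act u w = w" using assms(3) by (auto simp: stab_def)
  have e: "act (h \<otimes> u) w = act h w" using assms u by (simp add: act_mult reps_elts)
  have "section_at (act h w) \<in> carrier H"
    using section_at act_closed assms reps_elts by blast
  then have "inv (section_at (act h w)) \<otimes> (h \<otimes> u) = inv (section_at (act h w)) \<otimes> h \<otimes> u"
    using assms(2) u by (simp add: m_assoc)
  then show ?thesis unfolding \<psi>_def e
    using \<phi>_mult[OF assms(1) section_stab[OF assms(1,2)] assms(3)] by simp
qed

definition transition :: "'x \<Rightarrow> 'x \<Rightarrow> 'k" where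
  "transition x y =
     (let t = SOME t. t \<in> carrier H \<and> act t (rep x) = x \<and> act t (rep y) = y
      in \<psi> (rep x) t \<otimes>\<^bsub>K\<^esub> inv\<^bsub>K\<^esub> (\<psi> (rep y) t))"

text \<open>Another choice of \<open>t\<close> differs on the right by an element \<open>u\<close> that stabilizes both
  representatives. There \<open>\<phi> v u = \<phi> w u\<close>, so that these two factors cancel.\<close>

lemma transition_eq:
  assumes v: "v \<in> reps" and w: "w \<in> reps" and i: "inc \<Delta> v w" and h: "h \<in> carrier H"
  shows "transition (act h v) (act h w) = \<psi> v h \<otimes>\<^bsub>K\<^esub> inv\<^bsub>K\<^esub> (\<psi> w h)"
proof -
  have r: "rep (act h v) = v" "rep (act h w) = w"
    using v w h by (auto simp: reps_def rep_act)
  define t where "t = (SOME t. t \<in> carrier H \<and> act t v = act h v \<and> act t w = act h w)"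
  have t: "t \<in> carrier H \<and> act t v = act h v \<and> act t w = act h w"
    unfolding t_def by (rule someI[of _ h]) (simp add: h)
  let ?u = "inv h \<otimes> t"
  have u: "?u \<in> stab v" "?u \<in> stab w" using stab_quotient[OF h, of t] t v w reps_elts by metis+
  have th: "h \<otimes> ?u = t" using t h by (simp add: m_assoc[symmetric])
  have cl: "\<psi> v h \<in> carrier K" "\<psi> w h \<in> carrier K" "\<phi> w ?u \<in> carrier K"
    using \<psi>_closed v w h \<phi>_closed u by auto
  have "transition (act h v) (act h w) = \<psi> v (h \<otimes> ?u) \<otimes>\<^bsub>K\<^esub> inv\<^bsub>K\<^esub> (\<psi> w (h \<otimes> ?u))"
    unfolding transition_def r Let_def t_def[symmetric] th ..
  also have "\<dots> = \<psi> v h \<otimes>\<^bsub>K\<^esub> \<phi> w ?u \<otimes>\<^bsub>K\<^esub> inv\<^bsub>K\<^esub> (\<psi> w h \<otimes>\<^bsub>K\<^esub> \<phi> w ?u)"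
    using \<psi>_mult_stab[OF v h u(1)] \<psi>_mult_stab[OF w h u(2)] \<phi>_compat[OF v w i u] by simp
  also have "\<dots> = \<psi> v h \<otimes>\<^bsub>K\<^esub> (\<phi> w ?u \<otimes>\<^bsub>K\<^esub> inv\<^bsub>K\<^esub> (\<phi> w ?u)) \<otimes>\<^bsub>K\<^esub> inv\<^bsub>K\<^esub> (\<psi> w h)"
    using cl by (simp only: K.inv_mult_group K.m_assoc K.inv_closed K.m_closed)
  also have "\<dots> = \<psi> v h \<otimes>\<^bsub>K\<^esub> inv\<^bsub>K\<^esub> (\<psi> w h)" using cl by simp
  finally show ?thesis .
qed

lemma reps_inc:
  assumes "x \<in> elts \<Delta>" "y \<in> elts \<Delta>" "inc \<Delta> x y"
  shows "inc \<Delta> (rep x) (rep y)"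
proof (cases "ty \<Delta> x = ty \<Delta> y")
  case True
  then show ?thesis using assms inc_ty inc_refl rep_closed by metis
qed (use assms rep_inc in blast)

text \<open>A single group element carries the three representatives to a given triangle; with this common
  choice the three transitions telescope.\<close>

lemma cocycle_transition: "cocycle K \<Delta> transition"
proof
  fix x y assume xy: "x \<in> elts \<Delta>" "y \<in> elts \<Delta>" "inc \<Delta> x y"
  obtain t where t: "t \<in> carrier H" "act t (rep x) = x" "act t (rep y) = y"
    using transitive2[OF xy] by blast
  have "transition x y = \<psi> (rep x) t \<otimes>\<^bsub>K\<^esub> inv\<^bsub>K\<^esub> (\<psi> (rep y) t)"
    using transition_eq[of "rep x" "rep y" t] t reps_inc xy rep_in_reps by simp
  then show "transition x y \<in> carrier K" using \<psi>_closed rep_in_reps xy t by simp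
next
  fix x y z assume xyz: "x \<in> elts \<Delta>" "y \<in> elts \<Delta>" "z \<in> elts \<Delta>"
    "inc \<Delta> x y" "inc \<Delta> y z" "inc \<Delta> x z"
  obtain t where t: "t \<in> carrier H" "act t (rep x) = x" "act t (rep y) = y" "act t (rep z) = z"
    using transitive[OF xyz] by blast
  let ?a = "\<psi> (rep x) t" and ?b = "\<psi> (rep y) t" and ?c = "\<psi> (rep z) t"
  have cl: "?a \<in> carrier K" "?b \<in> carrier K" "?c \<in> carrier K"
    using \<psi>_closed rep_in_reps xyz t by auto
  have e: "transition x y = ?a \<otimes>\<^bsub>K\<^esub> inv\<^bsub>K\<^esub> ?b" "transition y z = ?b \<otimes>\<^bsub>K\<^esub> inv\<^bsub>K\<^esub> ?c"
    "transition x z = ?a \<otimes>\<^bsub>K\<^esub> inv\<^bsub>K\<^esub> ?c"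
    using transition_eq[of "rep x" "rep y" t] transition_eq[of "rep y" "rep z" t]
      transition_eq[of "rep x" "rep z" t] t reps_inc xyz rep_in_reps by auto
  have "transition x y \<otimes>\<^bsub>K\<^esub> transition y z = ?a \<otimes>\<^bsub>K\<^esub> (inv\<^bsub>K\<^esub> ?b \<otimes>\<^bsub>K\<^esub> ?b) \<otimes>\<^bsub>K\<^esub> inv\<^bsub>K\<^esub> ?c"
    unfolding e using cl by (simp only: K.m_assoc K.inv_closed K.m_closed)
  then show "transition x y \<otimes>\<^bsub>K\<^esub> transition y z = transition x z"
    unfolding e using cl by simp
qed (use inc_refl inc_sym in auto)

text \<open>Correcting \<open>\<psi> w\<close> by the potential \<open>f\<close> of the transitions gives maps \<open>q _ w\<close> that are equivariant for
  \<open>stab w\<close> and agree for incident representatives, hence for all of them. The common map is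
  therefore equivariant for all stabilizers at once.\<close>

lemma right_equivariant_map:
  assumes sc: "simply_connected_geom \<Delta>" and ne: "elts \<Delta> \<noteq> {}"
  obtains F where "\<And>h. h \<in> carrier H \<Longrightarrow> F h \<in> carrier K"
    "\<And>h w u. \<lbrakk>h \<in> carrier H; w \<in> reps; u \<in> stab w\<rbrakk> \<Longrightarrow> F (h \<otimes> u) = F h \<otimes>\<^bsub>K\<^esub> \<phi> w u"
proof -
  interpret c: cocycle K \<Delta> transition by (rule cocycle_transition)
  obtain f where f: "\<And>x. x \<in> elts \<Delta> \<Longrightarrow> f x \<in> carrier K"
    "\<And>x y. \<lbrakk>x \<in> elts \<Delta>; y \<in> elts \<Delta>; inc \<Delta> x y\<rbrakk> \<Longrightarrow> f y = f x \<otimes>\<^bsub>K\<^esub> transition x y"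
    using c.simply_connected_potential[OF sc] by metis
  obtain b where b: "b \<in> reps" using ne rep_in_reps by blast
  define q where "q h w = f (act h w) \<otimes>\<^bsub>K\<^esub> \<psi> w h" for h w
  have adj: "q h v = q h w" if h: "h \<in> carrier H" and vw: "v \<in> reps" "w \<in> reps" "inc \<Delta> v w" for h v w
  proof -
    have e: "act h v \<in> elts \<Delta>" "act h w \<in> elts \<Delta>" "inc \<Delta> (act h v) (act h w)"
      using h vw reps_elts act_closed act_inc by auto
    have cl: "f (act h v) \<in> carrier K" "\<psi> v h \<in> carrier K" "\<psi> w h \<in> carrier K"
      using f(1) e \<psi>_closed vw h by auto
    have "q h w = f (act h v) \<otimes>\<^bsub>K\<^esub> (\<psi> v h \<otimes>\<^bsub>K\<^esub> inv\<^bsub>K\<^esub> (\<psi> w h)) \<otimes>\<^bsub>K\<^esub> \<psi> w h"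
      unfolding q_def using f(2)[OF e] transition_eq[OF vw h] by simp
    also have "\<dots> = f (act h v) \<otimes>\<^bsub>K\<^esub> \<psi> v h \<otimes>\<^bsub>K\<^esub> (inv\<^bsub>K\<^esub> (\<psi> w h) \<otimes>\<^bsub>K\<^esub> \<psi> w h)"
      using cl by (simp only: K.m_assoc K.inv_closed K.m_closed)
    also have "\<dots> = q h v" using cl by (simp add: q_def)
    finally show ?thesis by simp
  qed
  have conn: "connected_geom \<Delta>" using sc by (simp add: simply_connected_geom_def)
  have qb: "q h w = q h b" if "h \<in> carrier H" "w \<in> reps" for h w
    by (rule reps_linked[OF conn _ that(2) b]) (rule adj[OF that(1)])
  have q_closed: "q h w \<in> carrier K" if "h \<in> carrier H" "w \<in> reps" for h w
    using that f(1) act_closed reps_elts \<psi>_closed by (simp add: q_def)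
  show ?thesis
  proof (rule that[of "\<lambda>h. q h b"])
    show "q h b \<in> carrier K" if "h \<in> carrier H" for h using q_closed[OF that b] .
    show "q (h \<otimes> u) b = q h b \<otimes>\<^bsub>K\<^esub> \<phi> w u"
      if h: "h \<in> carrier H" and w: "w \<in> reps" and u: "u \<in> stab w" for h w u
    proof -
      have u': "u \<in> carrier H" "act u w = w" using u by (auto simp: stab_def)
      have "act (h \<otimes> u) w = act h w" using h u' w by (simp add: act_mult reps_elts)
      then have "q (h \<otimes> u) w = q h w \<otimes>\<^bsub>K\<^esub> \<phi> w u"
        unfolding q_def
        using \<psi>_mult_stab[OF w h u] f(1) act_closed reps_elts w h \<psi>_closed \<phi>_closed u
        by (simp add: K.m_assoc)
      then show ?thesis using qb[OF h w] qb[OF m_closed[OF h u'(1)] w] by simp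
    qed
  qed
qed

text \<open>The elements \<open>h\<close> with \<open>\<Phi> (g h) = \<Phi> g * \<Phi> h\<close> for all \<open>g\<close> form a subgroup. For the normalized
  equivariant map it contains the stabilizers, which generate \<open>H\<close>.\<close>

theorem extend_to_group:
  assumes sc: "simply_connected_geom \<Delta>" and ne: "elts \<Delta> \<noteq> {}"
  obtains \<Phi> where "\<Phi> \<in> hom H K" "\<And>w u. \<lbrakk>w \<in> reps; u \<in> stab w\<rbrakk> \<Longrightarrow> \<Phi> u = \<phi> w u"
proof -
  obtain F where F: "\<And>h. h \<in> carrier H \<Longrightarrow> F h \<in> carrier K"
    "\<And>h w u. \<lbrakk>h \<in> carrier H; w \<in> reps; u \<in> stab w\<rbrakk> \<Longrightarrow> F (h \<otimes> u) = F h \<otimes>\<^bsub>K\<^esub> \<phi> w u"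
    using right_equivariant_map[OF sc ne] by metis
  define \<Phi> where "\<Phi> h = inv\<^bsub>K\<^esub> (F \<one>) \<otimes>\<^bsub>K\<^esub> F h" for h
  have cl: "\<Phi> h \<in> carrier K" if "h \<in> carrier H" for h using F(1) that by (simp add: \<Phi>_def)
  have one: "\<Phi> \<one> = \<one>\<^bsub>K\<^esub>" using F(1) by (simp add: \<Phi>_def)
  have equi: "\<Phi> (h \<otimes> u) = \<Phi> h \<otimes>\<^bsub>K\<^esub> \<phi> w u" if "h \<in> carrier H" "w \<in> reps" "u \<in> stab w" for h w u
    using F that \<phi>_closed by (simp add: \<Phi>_def K.m_assoc)
  have ext: "\<Phi> u = \<phi> w u" if "w \<in> reps" "u \<in> stab w" for w u
    using equi[OF one_closed that] \<phi>_closed that by (simp add: one stab_def)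
  let ?S = "{h \<in> carrier H. \<forall>g\<in>carrier H. \<Phi> (g \<otimes> h) = \<Phi> g \<otimes>\<^bsub>K\<^esub> \<Phi> h}"
  have "subgroup ?S H"
  proof (rule subgroupI)
    show "?S \<noteq> {}" using one cl by auto
  next
    fix a assume a: "a \<in> ?S"
    have r: "\<Phi> (g \<otimes> inv a) = \<Phi> g \<otimes>\<^bsub>K\<^esub> inv\<^bsub>K\<^esub> (\<Phi> a)" if g: "g \<in> carrier H" for g
    proof -
      have "\<Phi> g = \<Phi> (g \<otimes> inv a \<otimes> a)" using a g by (simp add: m_assoc)
      also have "\<dots> = \<Phi> (g \<otimes> inv a) \<otimes>\<^bsub>K\<^esub> \<Phi> a" using a g by simp
      finally show ?thesis using a g cl by (simp add: K.inv_solve_right)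
    qed
    have "\<Phi> (inv a) = inv\<^bsub>K\<^esub> (\<Phi> a)" using r[OF one_closed] a cl by (simp add: one)
    then show "inv a \<in> ?S" using a r by simp
  next
    fix a b assume ab: "a \<in> ?S" "b \<in> ?S"
    have "\<Phi> (g \<otimes> (a \<otimes> b)) = \<Phi> g \<otimes>\<^bsub>K\<^esub> \<Phi> (a \<otimes> b)" if g: "g \<in> carrier H" for g
    proof -
      have "\<Phi> (g \<otimes> (a \<otimes> b)) = \<Phi> (g \<otimes> a \<otimes> b)" using ab g by (simp add: m_assoc)
      also have "\<dots> = \<Phi> g \<otimes>\<^bsub>K\<^esub> \<Phi> a \<otimes>\<^bsub>K\<^esub> \<Phi> b" using ab g by simp
      finally show ?thesis using ab g cl by (simp add: K.m_assoc)
    qed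
    then show "a \<otimes> b \<in> ?S" using ab by simp
  qed auto
  moreover have "stab w \<subseteq> ?S" if "w \<in> reps" for w
    using equi that ext by (auto simp: stab_def)
  ultimately have "carrier H \<subseteq> ?S"
    using sc by (intro stabilizers_generate[OF _ ne]) (auto simp: simply_connected_geom_def)
  then have "\<Phi> \<in> hom H K" using cl by (intro homI) auto
  then show ?thesis using that ext by blast
qed

end

section \<open>Groups of automorphisms with a hall of orbit representatives\<close>

text \<open>An orbit consists of elements of a single type, so that representatives chosen separately for each
  type have the property \<open>orbits\<close>.\<close>

locale hall_geometry =
  fixes \<Gamma> :: "('x, 'i) pregeom" and G :: "('x \<Rightarrow> 'x) set" and W :: "'x set"
  assumes geometry: "geometry \<Gamma>"
    and finite_types: "finite (types \<Gamma>)"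
    and G: "subgroup G (aut_group \<Gamma>)"
    and hall: "hall \<Gamma> W"
    and orbits: "x \<in> elts \<Gamma> \<Longrightarrow> \<exists>!w. w \<in> W \<and> x \<in> geom_orbit \<Gamma> G w"
    and flag_trans: "\<lbrakk>V \<subseteq> W; flag \<Gamma> V\<rbrakk> \<Longrightarrow> flag_transitive G (orbit_pregeom \<Gamma> G V)"
begin

abbreviation stab_group :: "'x set \<Rightarrow> ('x \<Rightarrow> 'x) monoid" where
  "stab_group U \<equiv> aut_subgroup \<Gamma> (parabolic G U)"

lemma inc_refl: "x \<in> elts \<Gamma> \<Longrightarrow> inc \<Gamma> x x"
  and inc_sym: "\<lbrakk>x \<in> elts \<Gamma>; y \<in> elts \<Gamma>; inc \<Gamma> x y\<rbrakk> \<Longrightarrow> inc \<Gamma> y x"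
  and inc_ty: "\<lbrakk>x \<in> elts \<Gamma>; y \<in> elts \<Gamma>; inc \<Gamma> x y; ty \<Gamma> x = ty \<Gamma> y\<rbrakk> \<Longrightarrow> x = y"
  and ty_elts: "ty \<Gamma> ` elts \<Gamma> = types \<Gamma>"
  using geometry unfolding geometry_def pregeometry_def reflp_on_def symp_on_def by blast+

lemma W_elts: "W \<subseteq> elts \<Gamma>" and ty_W: "ty \<Gamma> ` W = types \<Gamma>"
  and hall_flag: "\<lbrakk>V \<subseteq> W; inj_on (ty \<Gamma>) V\<rbrakk> \<Longrightarrow> flag \<Gamma> V"
  using hall by (auto simp: hall_def)

lemma flag_inj: "flag \<Gamma> F \<Longrightarrow> inj_on (ty \<Gamma>) F"
  unfolding flag_def by (intro inj_onI inc_ty) auto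

lemma flag_finite: "flag \<Gamma> F \<Longrightarrow> finite F"
  using flag_inj[of F] ty_elts finite_types
  by (metis flag_def finite_imageD finite_subset image_mono)

lemma flag_card: "flag \<Gamma> F \<Longrightarrow> card F = card (ty \<Gamma> ` F)"
  using flag_inj by (simp add: card_image)

lemma flag_types: "flag \<Gamma> F \<Longrightarrow> ty \<Gamma> ` F \<subseteq> types \<Gamma>"
  using ty_elts by (auto simp: flag_def)

lemma rank_residue: "flag \<Gamma> U \<Longrightarrow> rank (residue \<Gamma> U) = rank \<Gamma> - card U"
  using flag_types[of U] flag_card[of U] finite_types
  by (simp add: rank_def residue_def card_Diff_subset finite_subset)

lemma G_elt:
  assumes "g \<in> G"
  shows "x \<in> elts \<Gamma> \<Longrightarrow> g x \<in> elts \<Gamma>" "x \<in> elts \<Gamma> \<Longrightarrow> ty \<Gamma> (g x) = ty \<Gamma> x"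
    "\<lbrakk>x \<in> elts \<Gamma>; y \<in> elts \<Gamma>\<rbrakk> \<Longrightarrow> inc \<Gamma> (g x) (g y) = inc \<Gamma> x y"
proof -
  have "g \<in> geom_auts \<Gamma>" using subgroup.subset[OF G] assms by (auto simp: aut_group_def)
  then show "x \<in> elts \<Gamma> \<Longrightarrow> g x \<in> elts \<Gamma>" "x \<in> elts \<Gamma> \<Longrightarrow> ty \<Gamma> (g x) = ty \<Gamma> x"
    "\<lbrakk>x \<in> elts \<Gamma>; y \<in> elts \<Gamma>\<rbrakk> \<Longrightarrow> inc \<Gamma> (g x) (g y) = inc \<Gamma> x y"
    by (auto simp: geom_auts_def dest: Bij_imp_funcset)
qed

lemma mult_apply:
  assumes "g \<in> G" "h \<in> G" "x \<in> elts \<Gamma>"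
  shows "(g \<otimes>\<^bsub>aut_group \<Gamma>\<^esub> h) x = g (h x)"
proof -
  have "g \<in> Bij (elts \<Gamma>)" "h \<in> Bij (elts \<Gamma>)"
    using subgroup.subset[OF G] assms by (auto simp: aut_group_def geom_auts_def)
  then show ?thesis using assms(3) by (simp add: aut_group_def BijGroup_def compose_eq)
qed

lemma one_apply: "x \<in> elts \<Gamma> \<Longrightarrow> \<one>\<^bsub>aut_group \<Gamma>\<^esub> x = x"
  by (simp add: aut_group_def BijGroup_def)

lemma orbit_iff: "y \<in> geom_orbit \<Gamma> G x \<longleftrightarrow> (\<exists>g\<in>G. y = g x)"
  by (auto simp: orbit_def)

lemma group_G: "group (aut_subgroup \<Gamma> G)"
  by (rule group_aut_subgroup[OF G])

lemma subgroup_stab: "U \<subseteq> elts \<Gamma> \<Longrightarrow> subgroup (parabolic G U) (aut_subgroup \<Gamma> G)"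
  by (rule subgroup_parabolic[OF G])

lemma group_stab: "U \<subseteq> elts \<Gamma> \<Longrightarrow> group (stab_group U)"
  using subgroup.subgroup_is_group[OF subgroup_stab group_G] by simp

definition rep :: "'x \<Rightarrow> 'x" where
  "rep x = (THE w. w \<in> W \<and> x \<in> geom_orbit \<Gamma> G w)"

lemma rep: assumes "x \<in> elts \<Gamma>" shows "rep x \<in> W" "x \<in> geom_orbit \<Gamma> G (rep x)"
  using theI'[OF orbits[OF assms]] by (auto simp: rep_def)

lemma rep_eq: "\<lbrakk>x \<in> elts \<Gamma>; w \<in> W; x \<in> geom_orbit \<Gamma> G w\<rbrakk> \<Longrightarrow> rep x = w"
  unfolding rep_def using orbits by (intro the1_equality) auto

lemma rep_ty: "x \<in> elts \<Gamma> \<Longrightarrow> ty \<Gamma> (rep x) = ty \<Gamma> x"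
  using rep[of x] G_elt(2) W_elts unfolding orbit_iff by force

lemma one_G: "\<one>\<^bsub>aut_group \<Gamma>\<^esub> \<in> G"
  using subgroup.one_closed[OF G] .

lemma rep_W: "w \<in> W \<Longrightarrow> rep w = w"
  using rep_eq[of w w] W_elts one_G one_apply[of w] unfolding orbit_iff by (metis subsetD)

lemma rep_act:
  assumes "g \<in> G" "x \<in> elts \<Gamma>"
  shows "rep (g x) = rep x"
proof -
  obtain h where h: "h \<in> G" "x = h (rep x)" using rep(2)[OF assms(2)] unfolding orbit_iff by blast
  have "g \<otimes>\<^bsub>aut_group \<Gamma>\<^esub> h \<in> G" using subgroup.m_closed[OF G] assms h by simp
  moreover have "g x = (g \<otimes>\<^bsub>aut_group \<Gamma>\<^esub> h) (rep x)"
    using mult_apply[OF assms(1) h(1)] h(2) rep(1)[OF assms(2)] W_elts by (metis subsetD)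
  ultimately show ?thesis using rep_eq[of "g x" "rep x"] assms G_elt(1) rep(1) unfolding orbit_iff by metis
qed

text \<open>The representatives of the elements of \<open>F\<close> have pairwise different types, so they form a flag \<open>V\<close>
  of the hall, of the same type as \<open>F\<close>. Both are flags of the orbit pregeometry of \<open>V\<close>, on which \<open>G\<close>
  is flag-transitive, and \<open>G\<close> preserves types.\<close>

lemma flag_conjugate_to_reps:
  assumes F: "flag \<Gamma> F"
  obtains g where "g \<in> G" "\<And>x. x \<in> F \<Longrightarrow> g (rep x) = x"
proof -
  have Fx: "F \<subseteq> elts \<Gamma>" using F by (simp add: flag_def)
  let ?V = "rep ` F"
  have V: "?V \<subseteq> W" using Fx rep by auto
  have tyV: "ty \<Gamma> ` ?V = ty \<Gamma> ` F" using Fx rep_ty by (force simp: image_image)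
  have inj: "inj_on (ty \<Gamma>) ?V"
  proof (rule inj_onI, clarify)
    fix x y assume xy: "x \<in> F" "y \<in> F" "ty \<Gamma> (rep x) = ty \<Gamma> (rep y)"
    then have "ty \<Gamma> x = ty \<Gamma> y" using Fx rep_ty by (metis subsetD)
    then show "rep x = rep y" using inj_onD[OF flag_inj[OF F]] xy by metis
  qed
  have flagV: "flag \<Gamma> ?V" using hall_flag V inj by blast
  let ?\<Delta> = "orbit_pregeom \<Gamma> G ?V"
  have "F \<subseteq> elts ?\<Delta>" using rep Fx by (auto simp: orbit_pregeom_def)
  moreover have "?V \<subseteq> elts ?\<Delta>"
  proof
    fix v assume v: "v \<in> ?V"
    have "v \<in> geom_orbit \<Gamma> G v"
      using one_G one_apply[of v] v V W_elts unfolding orbit_iff by (metis subsetD)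
    then show "v \<in> elts ?\<Delta>" using v unfolding orbit_pregeom_def by auto
  qed
  ultimately have "flag ?\<Delta> F" "flag ?\<Delta> ?V"
    using F flagV by (auto simp: flag_def orbit_pregeom_def)
  moreover have "ty ?\<Delta> ` ?V = ty ?\<Delta> ` F" using tyV by (simp add: orbit_pregeom_def)
  ultimately have "\<exists>g\<in>G. g ` ?V = F"
    by (intro flag_trans[OF V flagV, unfolded flag_transitive_def, rule_format] conjI)
  then obtain g where g: "g \<in> G" "g ` ?V = F" by blast
  have "g (rep x) = x" if x: "x \<in> F" for x
  proof -
    have "g (rep x) \<in> F" using g x by blast
    moreover have "ty \<Gamma> (g (rep x)) = ty \<Gamma> x"
      using G_elt(2)[OF g(1)] rep(1) rep_ty x Fx W_elts by (metis subsetD)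
    ultimately show ?thesis using inj_onD[OF flag_inj[OF F]] x by blast
  qed
  then show ?thesis using that g by blast
qed

lemma residue_elts:
  "elts (residue \<Gamma> U) = {x \<in> elts \<Gamma>. ty \<Gamma> x \<notin> ty \<Gamma> ` U \<and> flag \<Gamma> (insert x U)}"
  and residue_inc: "inc (residue \<Gamma> U) = inc \<Gamma>" and residue_ty: "ty (residue \<Gamma> U) = ty \<Gamma>"
  by (simp_all add: residue_def)

lemma residue_W:
  assumes "U \<subseteq> W" "flag \<Gamma> U" "w \<in> W" "ty \<Gamma> w \<notin> ty \<Gamma> ` U"
  shows "w \<in> elts (residue \<Gamma> U)"
proof -
  have "inj_on (ty \<Gamma>) (insert w U)" using flag_inj[OF assms(2)] assms(4) by auto
  then show ?thesis using hall_flag[of "insert w U"] assms W_elts by (auto simp: residue_elts)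
qed

lemma parabolic_iff: "g \<in> parabolic G U \<longleftrightarrow> g \<in> G \<and> (\<forall>u\<in>U. g u = u)"
  by (simp add: parabolic_def)

lemma parabolic_insert: "g \<in> parabolic G (insert w U) \<longleftrightarrow> g \<in> parabolic G U \<and> g w = w"
  by (auto simp: parabolic_def)

text \<open>An element of \<open>G\<close> that conjugates the flag \<open>U \<union> {x, y, z}\<close> to its representatives fixes \<open>U\<close>
  pointwise, because the elements of \<open>U \<subseteq> W\<close> are their own representatives. Thus transitivity of
  \<open>G\<close> on flags of \<open>\<Gamma>\<close> becomes transitivity of \<open>G\<^sub>U\<close> on flags of the residue.\<close>

lemma hall_action_residue:
  assumes U: "U \<subseteq> W" and flagU: "flag \<Gamma> U"
  shows "hall_action (stab_group U) (residue \<Gamma> U) (\<lambda>g. g) rep"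
proof -
  let ?\<Delta> = "residue \<Gamma> U"
  have Ux: "U \<subseteq> elts \<Gamma>" using U W_elts by blast
  have el: "x \<in> elts \<Gamma>" if "x \<in> elts ?\<Delta>" for x using that by (simp add: residue_elts)
  have rep_res: "rep x \<in> elts ?\<Delta>" if "x \<in> elts ?\<Delta>" for x
    using that residue_W[OF U flagU rep(1)] rep_ty by (simp add: residue_elts)
  interpret stab: group "stab_group U" by (rule group_stab[OF Ux])
  show ?thesis
  proof (unfold_locales, unfold residue_inc residue_ty)
    fix h x assume h: "h \<in> carrier (stab_group U)" and x: "x \<in> elts ?\<Delta>"
    then have hG: "h \<in> G" and fixU: "\<And>u. u \<in> U \<Longrightarrow> h u = u" by (auto simp: parabolic_def)
    have x': "x \<in> elts \<Gamma>" "ty \<Gamma> x \<notin> ty \<Gamma> ` U" "flag \<Gamma> (insert x U)"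
      using x by (auto simp: residue_elts)
    have "inc \<Gamma> (h x) u = inc \<Gamma> x u" "inc \<Gamma> u (h x) = inc \<Gamma> u x" if "u \<in> U" for u
      using G_elt(3)[OF hG, of x u] G_elt(3)[OF hG, of u x] fixU[OF that] that Ux x' by auto
    then have "flag \<Gamma> (insert (h x) U)"
      using x' G_elt(1)[OF hG] inc_refl by (auto simp: flag_def)
    then show "h x \<in> elts ?\<Delta>" using x' G_elt[OF hG] by (simp add: residue_elts)
    show "rep (h x) = rep x" using rep_act hG x' by blast
  next
    fix g h x assume "g \<in> carrier (stab_group U)" "h \<in> carrier (stab_group U)" "x \<in> elts ?\<Delta>"
    then show "(g \<otimes>\<^bsub>stab_group U\<^esub> h) x = g (h x)"
      using mult_apply el by (simp add: parabolic_iff)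
  next
    fix x y assume "x \<in> elts ?\<Delta>" "y \<in> elts ?\<Delta>" "ty \<Gamma> x \<noteq> ty \<Gamma> y"
    then have "flag \<Gamma> {rep x, rep y}"
      using rep el rep_ty by (intro hall_flag) auto
    then show "inc \<Gamma> (rep x) (rep y)" by (simp add: flag_def)
  next
    fix x y z assume xyz: "x \<in> elts ?\<Delta>" "y \<in> elts ?\<Delta>" "z \<in> elts ?\<Delta>"
      "inc \<Gamma> x y" "inc \<Gamma> y z" "inc \<Gamma> x z"
    have "flag \<Gamma> (insert x (insert y (insert z U)))"
    proof -
      have "inc \<Gamma> v v \<and> v \<in> elts \<Gamma> \<and> (\<forall>u\<in>U. inc \<Gamma> v u \<and> inc \<Gamma> u v)" if "v \<in> elts ?\<Delta>" for v
        using that by (simp add: residue_elts flag_def)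
      moreover have "inc \<Gamma> y x" "inc \<Gamma> z y" "inc \<Gamma> z x" using xyz el inc_sym by blast+
      ultimately show ?thesis using xyz flagU unfolding flag_def by simp
    qed
    then obtain t where t: "t \<in> G" "\<And>u. u \<in> insert x (insert y (insert z U)) \<Longrightarrow> t (rep u) = u"
      using flag_conjugate_to_reps by blast
    have "t u = u" if "u \<in> U" for u using t(2)[of u] rep_W[of u] U that by auto
    then show "\<exists>t\<in>carrier (stab_group U). t (rep x) = x \<and> t (rep y) = y \<and> t (rep z) = z"
      using t by (intro bexI[of _ t]) (auto simp: parabolic_def)
  qed (use el inc_refl inc_sym inc_ty rep_res rep_W rep rep_ty one_apply G_elt(3) in
      \<open>auto simp: parabolic_iff\<close>)
qed

lemma residue_reps:
  assumes "U \<subseteq> W" "flag \<Gamma> U"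
  shows "w \<in> hall_action.reps (residue \<Gamma> U) rep \<longleftrightarrow> w \<in> W \<and> ty \<Gamma> w \<notin> ty \<Gamma> ` U"
proof -
  interpret hall_action "stab_group U" "residue \<Gamma> U" "\<lambda>g. g" rep
    by (rule hall_action_residue[OF assms])
  show ?thesis
    using residue_W[OF assms, of w] rep[of w] rep_W[of w] unfolding reps_def
    by (auto simp: residue_elts)
qed

lemma residue_stab:
  assumes "U \<subseteq> W" "flag \<Gamma> U"
  shows "hall_action.stab (stab_group U) (\<lambda>g. g) w = parabolic G (insert w U)"
proof -
  interpret hall_action "stab_group U" "residue \<Gamma> U" "\<lambda>g. g" rep
    by (rule hall_action_residue[OF assms])
  show ?thesis using parabolic_insert[of _ w U] by (auto simp: stab_def)
qed

lemma residue_nonempty: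
  assumes "U \<subseteq> W" "flag \<Gamma> U" "card U < rank \<Gamma>"
  shows "elts (residue \<Gamma> U) \<noteq> {}"
proof -
  have "ty \<Gamma> ` U \<noteq> types \<Gamma>" using assms(3) flag_card[OF assms(2)] by (auto simp: rank_def)
  then obtain i where i: "i \<in> types \<Gamma>" "i \<notin> ty \<Gamma> ` U" using flag_types[OF assms(2)] by blast
  then obtain w where "w \<in> W" "ty \<Gamma> w = i" unfolding ty_W[symmetric] by blast
  then show ?thesis using residue_W[OF assms(1,2)] i(2) by blast
qed

lemma insert_flag:
  assumes "U \<subseteq> W" "flag \<Gamma> U" "w \<in> W" "ty \<Gamma> w \<notin> ty \<Gamma> ` U"
  shows "insert w U \<subseteq> W" "flag \<Gamma> (insert w U)" "card (insert w U) = Suc (card U)"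
proof -
  show "insert w U \<subseteq> W" using assms by blast
  show "flag \<Gamma> (insert w U)" using residue_W[OF assms] by (simp add: residue_elts)
  have "w \<notin> U" using assms by blast
  then show "card (insert w U) = Suc (card U)" using flag_finite[OF assms(2)] by simp
qed

definition W_flags :: "nat \<Rightarrow> 'x set set" where
  "W_flags m = {U. U \<subseteq> W \<and> flag \<Gamma> U \<and> m \<le> card U}"

lemma parabolics_generate_step:
  assumes S: "subgroup S (aut_subgroup \<Gamma> G)"
    and m: "m < rank \<Gamma>"
    and conn: "\<And>U. \<lbrakk>U \<subseteq> W; flag \<Gamma> U; card U = m\<rbrakk> \<Longrightarrow> connected_geom (residue \<Gamma> U)"
    and sub: "\<And>U. U \<in> W_flags (Suc m) \<Longrightarrow> parabolic G U \<subseteq> S"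
    and U: "U \<in> W_flags m"
  shows "parabolic G U \<subseteq> S"
proof (cases "card U = m")
  case False
  then show ?thesis using sub U by (auto simp: W_flags_def)
next
  case True
  have U': "U \<subseteq> W" "flag \<Gamma> U" using U by (auto simp: W_flags_def)
  have Ux: "U \<subseteq> elts \<Gamma>" using U' W_elts by blast
  interpret act: hall_action "stab_group U" "residue \<Gamma> U" "\<lambda>g. g" rep
    by (rule hall_action_residue[OF U'])
  interpret G: group "aut_subgroup \<Gamma> G" by (rule group_G)
  have "subgroup (S \<inter> parabolic G U) ((aut_subgroup \<Gamma> G)\<lparr>carrier := parabolic G U\<rparr>)"
    using G.subgroup_incl[OF G.subgroups_Inter_pair[OF S subgroup_stab[OF Ux]] subgroup_stab[OF Ux]]
    by simp
  then have "subgroup (S \<inter> parabolic G U) (stab_group U)" by simp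
  moreover have "act.stab w \<subseteq> S \<inter> parabolic G U" if "w \<in> act.reps" for w
  proof -
    have "insert w U \<in> W_flags (Suc m)"
      using that insert_flag[OF U', of w] True unfolding residue_reps[OF U'] by (simp add: W_flags_def)
    then show ?thesis using sub parabolic_insert unfolding residue_stab[OF U'] by blast
  qed
  ultimately have "carrier (stab_group U) \<subseteq> S \<inter> parabolic G U"
    using conn[OF U' True] residue_nonempty[OF U'] True m by (intro act.stabilizers_generate) auto
  then show ?thesis by simp
qed

definition compatible_family ::
  "('k, 'n) monoid_scheme \<Rightarrow> nat \<Rightarrow> ('x set \<Rightarrow> ('x \<Rightarrow> 'x) \<Rightarrow> 'k) \<Rightarrow> bool" where
  "compatible_family K m \<phi> \<longleftrightarrow>
     (\<forall>U\<in>W_flags m. \<phi> U \<in> hom (stab_group U) K) \<and>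
     (\<forall>U\<in>W_flags m. \<forall>V\<in>W_flags m. U \<subseteq> V \<longrightarrow> (\<forall>g\<in>parabolic G V. \<phi> V g = \<phi> U g))"

text \<open>For a flag \<open>U\<close> of size \<open>m\<close> the homomorphisms on the subgroups \<open>G\<^bsub>U \<union> {w}\<^esub>\<close> are extended to \<open>G\<^sub>U\<close>.
  They agree on intersections for incident \<open>v\<close> and \<open>w\<close> because \<open>U \<union> {v, w}\<close> is again a flag of \<open>W\<close>.
  Distinct flags of the same size are not nested, so no condition relates the new homomorphisms
  to one another, and a larger flag contains some \<open>U \<union> {w}\<close>.\<close>

lemma compatible_family_step:
  assumes K: "group K"
    and m: "m < rank \<Gamma>"
    and sc: "\<And>U. \<lbrakk>U \<subseteq> W; flag \<Gamma> U; card U = m\<rbrakk> \<Longrightarrow> simply_connected_geom (residue \<Gamma> U)"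
    and \<phi>: "compatible_family K (Suc m) \<phi>"
  shows "\<exists>\<phi>'. compatible_family K m \<phi>' \<and> (\<forall>U\<in>W_flags (Suc m). \<phi>' U = \<phi> U)"
proof -
  have \<phi>_hom: "\<phi> U \<in> hom (stab_group U) K" if "U \<in> W_flags (Suc m)" for U
    using \<phi> that by (simp add: compatible_family_def)
  have \<phi>_eq: "\<phi> V g = \<phi> U g"
    if "U \<in> W_flags (Suc m)" "V \<in> W_flags (Suc m)" "U \<subseteq> V" "g \<in> parabolic G V" for U V g
    using \<phi> that by (simp add: compatible_family_def)
  define extends where "extends U \<Phi> \<longleftrightarrow> \<Phi> \<in> hom (stab_group U) K \<and>
      (\<forall>w g. w \<in> W \<and> ty \<Gamma> w \<notin> ty \<Gamma> ` U \<and> g \<in> parabolic G (insert w U) \<longrightarrow> \<Phi> g = \<phi> (insert w U) g)"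
    for U \<Phi>
  have ex: "\<exists>\<Phi>. extends U \<Phi>"
    if U: "U \<subseteq> W" "flag \<Gamma> U" "card U = m" for U
  proof -
    note reps = residue_reps[OF U(1,2)] and stab = residue_stab[OF U(1,2)]
    have ins: "insert w U \<in> W_flags (Suc m)" if "w \<in> W" "ty \<Gamma> w \<notin> ty \<Gamma> ` U" for w
      using insert_flag[OF U(1,2) that] U(3) by (simp add: W_flags_def)
    interpret act: hall_action "stab_group U" "residue \<Gamma> U" "\<lambda>g. g" rep
      by (rule hall_action_residue[OF U(1,2)])
    interpret K: group K by (rule K)
    interpret fam: hall_action_family "stab_group U" "residue \<Gamma> U" "\<lambda>g. g" rep K "\<lambda>w. \<phi> (insert w U)"
    proof (unfold_locales, unfold reps stab residue_inc)
      fix w u u' assume w: "w \<in> W \<and> ty \<Gamma> w \<notin> ty \<Gamma> ` U" and u: "u \<in> parabolic G (insert w U)"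
      have hom: "\<phi> (insert w U) \<in> hom (stab_group (insert w U)) K" using \<phi>_hom ins w by blast
      show "\<phi> (insert w U) u \<in> carrier K" using hom_in_carrier[OF hom] u by simp
      assume u': "u' \<in> parabolic G (insert w U)"
      show "\<phi> (insert w U) (u \<otimes>\<^bsub>stab_group U\<^esub> u') = \<phi> (insert w U) u \<otimes>\<^bsub>K\<^esub> \<phi> (insert w U) u'"
        using hom_mult[OF hom, of u u'] u u' by simp
    next
      fix v w u assume vw: "v \<in> W \<and> ty \<Gamma> v \<notin> ty \<Gamma> ` U" "w \<in> W \<and> ty \<Gamma> w \<notin> ty \<Gamma> ` U" "inc \<Gamma> v w"
        and u: "u \<in> parabolic G (insert v U)" "u \<in> parabolic G (insert w U)"
      show "\<phi> (insert v U) u = \<phi> (insert w U) u"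
      proof (cases "v = w")
        case False
        let ?V = "insert w (insert v U)"
        have v: "insert v U \<subseteq> W" "flag \<Gamma> (insert v U)" "card (insert v U) = Suc m"
          using insert_flag[OF U(1,2), of v] vw(1) U(3) by auto
        have "ty \<Gamma> v \<noteq> ty \<Gamma> w" using inc_ty[of v w] False vw W_elts by blast
        then have "?V \<in> W_flags (Suc m)"
          using insert_flag[OF v(1,2), of w] vw(2) v(3) by (auto simp: W_flags_def)
        moreover have "u \<in> parabolic G ?V" using u by (auto simp: parabolic_def)
        moreover have "insert v U \<subseteq> ?V" "insert w U \<subseteq> ?V" by auto
        ultimately show ?thesis
          using \<phi>_eq[of "insert v U" ?V u] \<phi>_eq[of "insert w U" ?V u] ins vw by metis
      qed simp
    qed
    obtain \<Phi> where "\<Phi> \<in> hom (stab_group U) K"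
      "\<And>w u. \<lbrakk>w \<in> act.reps; u \<in> act.stab w\<rbrakk> \<Longrightarrow> \<Phi> u = \<phi> (insert w U) u"
      using fam.extend_to_group[OF sc[OF U]] residue_nonempty[OF U(1,2)] U(3) m by metis
    then show ?thesis unfolding reps stab extends_def by blast
  qed
  define \<phi>' where "\<phi>' U = (if card U = m then SOME \<Phi>. extends U \<Phi> else \<phi> U)" for U
  have "extends U (\<phi>' U)" if U: "U \<subseteq> W" "flag \<Gamma> U" "card U = m" for U
    using someI_ex[OF ex[OF U]] U(3) by (simp add: \<phi>'_def)
  note new = this[unfolded extends_def]
  have old: "\<phi>' U = \<phi> U" if "U \<in> W_flags (Suc m)" for U
    using that by (auto simp: \<phi>'_def W_flags_def)
  have split: "U \<in> W_flags (Suc m) \<or> (U \<subseteq> W \<and> flag \<Gamma> U \<and> card U = m)" if "U \<in> W_flags m" for U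
    using that by (auto simp: W_flags_def)
  have "compatible_family K m \<phi>'"
    unfolding compatible_family_def
  proof (intro conjI ballI impI)
    fix U assume "U \<in> W_flags m"
    then show "\<phi>' U \<in> hom (stab_group U) K" using split[of U] old[of U] \<phi>_hom[of U] new[of U] by auto
  next
    fix U V g assume UV: "U \<in> W_flags m" "V \<in> W_flags m" "U \<subseteq> V" and g: "g \<in> parabolic G V"
    have V: "V \<subseteq> W" "flag \<Gamma> V" "finite V" using UV(2) flag_finite by (auto simp: W_flags_def)
    show "\<phi>' V g = \<phi>' U g"
    proof (cases "U = V")
      case False
      then obtain w where w: "w \<in> V" "w \<notin> U" using UV by blast
      have "card U < card V" using False UV V by (simp add: psubset_card_mono psubsetI)
      then have V': "V \<in> W_flags (Suc m)" using UV by (auto simp: W_flags_def)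
      show ?thesis
      proof (cases "U \<in> W_flags (Suc m)")
        case True
        then show ?thesis using old V' \<phi>_eq[OF True V' UV(3) g] by simp
      next
        case False
        then have U: "U \<subseteq> W" "flag \<Gamma> U" "card U = m" using split UV by auto
        have w': "w \<in> W" "ty \<Gamma> w \<notin> ty \<Gamma> ` U"
          using w V UV(3) inj_onD[OF flag_inj[OF V(2)]] by auto
        have "insert w U \<in> W_flags (Suc m)"
          using insert_flag[OF U(1,2) w'] U(3) by (simp add: W_flags_def)
        moreover have "insert w U \<subseteq> V" using w UV by blast
        ultimately have "\<phi> V g = \<phi> (insert w U) g" using \<phi>_eq V' g by blast
        moreover have "g \<in> parabolic G (insert w U)"
          using g \<open>insert w U \<subseteq> V\<close> by (auto simp: parabolic_def)
        ultimately show ?thesis using new[OF U] w' old[OF V'] by simp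
      qed
    qed simp
  qed
  then show ?thesis using old by blast
qed

lemma parabolics_generate:
  assumes S: "subgroup S (aut_subgroup \<Gamma> G)"
    and m: "m \<le> rank \<Gamma>"
    and conn: "\<And>U. \<lbrakk>U \<subseteq> W; flag \<Gamma> U; card U < m\<rbrakk> \<Longrightarrow> connected_geom (residue \<Gamma> U)"
    and sub: "\<And>U. U \<in> W_flags m \<Longrightarrow> parabolic G U \<subseteq> S"
  shows "G \<subseteq> S"
proof -
  have "\<forall>U\<in>W_flags 0. parabolic G U \<subseteq> S"
  proof (rule inc_induct[of 0 m "\<lambda>l. \<forall>U\<in>W_flags l. parabolic G U \<subseteq> S"])
    show "\<forall>U\<in>W_flags m. parabolic G U \<subseteq> S" using sub by blast
    show "\<forall>U\<in>W_flags l. parabolic G U \<subseteq> S"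
      if l: "l < m" "\<forall>U\<in>W_flags (Suc l). parabolic G U \<subseteq> S" for l
    proof
      fix U assume U: "U \<in> W_flags l"
      show "parabolic G U \<subseteq> S"
      proof (rule parabolics_generate_step[OF S _ _ _ U])
        show "l < rank \<Gamma>" using l(1) m by simp
        show "connected_geom (residue \<Gamma> U)" if "U \<subseteq> W" "flag \<Gamma> U" "card U = l" for U
          using conn that l(1) by blast
        show "parabolic G U \<subseteq> S" if "U \<in> W_flags (Suc l)" for U using l(2) that by blast
      qed
    qed
  qed simp
  moreover have "{} \<in> W_flags 0" by (simp add: W_flags_def flag_def)
  ultimately show ?thesis by (auto simp: parabolic_def)
qed

lemma compatible_family_extends:
  assumes K: "group K"
    and m: "m \<le> rank \<Gamma>"
    and sc: "\<And>U. \<lbrakk>U \<subseteq> W; flag \<Gamma> U; card U < m\<rbrakk> \<Longrightarrow> simply_connected_geom (residue \<Gamma> U)"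
    and \<phi>: "compatible_family K m \<phi>"
  obtains \<Phi> where "\<Phi> \<in> hom (aut_subgroup \<Gamma> G) K"
    "\<And>U g. \<lbrakk>U \<in> W_flags m; g \<in> parabolic G U\<rbrakk> \<Longrightarrow> \<Phi> g = \<phi> U g"
proof -
  have mono: "W_flags m \<subseteq> W_flags l" if "l \<le> m" for l using that by (auto simp: W_flags_def)
  have "\<exists>\<phi>'. compatible_family K 0 \<phi>' \<and> (\<forall>U\<in>W_flags m. \<phi>' U = \<phi> U)"
  proof (rule inc_induct[of 0 m "\<lambda>l. \<exists>\<phi>'. compatible_family K l \<phi>' \<and> (\<forall>U\<in>W_flags m. \<phi>' U = \<phi> U)"])
    fix l assume l: "l < m"
      and "\<exists>\<phi>'. compatible_family K (Suc l) \<phi>' \<and> (\<forall>U\<in>W_flags m. \<phi>' U = \<phi> U)"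
    then obtain \<phi>' where \<phi>': "compatible_family K (Suc l) \<phi>'" "\<forall>U\<in>W_flags m. \<phi>' U = \<phi> U" by blast
    obtain \<phi>'' where "compatible_family K l \<phi>''" "\<forall>U\<in>W_flags (Suc l). \<phi>'' U = \<phi>' U"
      using compatible_family_step[OF K _ _ \<phi>'(1)] l m sc by (metis order_less_le_trans)
    then show "\<exists>\<phi>'. compatible_family K l \<phi>' \<and> (\<forall>U\<in>W_flags m. \<phi>' U = \<phi> U)"
      using \<phi>'(2) mono[of "Suc l"] l by (intro exI[of _ \<phi>'']) auto
  qed (use \<phi> in auto)
  then obtain \<phi>' where \<phi>': "compatible_family K 0 \<phi>'" "\<And>U. U \<in> W_flags m \<Longrightarrow> \<phi>' U = \<phi> U"
    by blast
  have e: "{} \<in> W_flags 0" by (simp add: W_flags_def flag_def)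
  have G: "parabolic G {} = G" by (simp add: parabolic_def)
  show ?thesis
  proof (rule that[of "\<phi>' {}"])
    show "\<phi>' {} \<in> hom (aut_subgroup \<Gamma> G) K"
      using \<phi>'(1) e G unfolding compatible_family_def by metis
    show "\<phi>' {} g = \<phi> U g" if U: "U \<in> W_flags m" and g: "g \<in> parabolic G U" for U g
    proof -
      have "U \<in> W_flags 0" using mono[of 0] U by auto
      then have "\<phi>' U g = \<phi>' {} g" using \<phi>'(1) e g unfolding compatible_family_def by blast
      then show ?thesis using \<phi>'(2)[OF U] by simp
    qed
  qed
qed

end

section \<open>Recognizing a universal completion\<close>

text \<open>A homomorphism \<open>\<Psi>\<close> that sends \<open>g\<close> to the generator of each copy of \<open>g\<close> inverts the canonical one on
  the generators, hence on all words.\<close>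

lemma canonical_hom_iso:
  fixes H :: "('a, 'm) monoid_scheme" and A :: "('j, 'a) amalgam"
  assumes H: "group H" and A: "subgroup_amalgam H A"
    and gen: "\<And>S. \<lbrakk>subgroup S H; \<And>j. j \<in> index A \<Longrightarrow> carrier (grp A j) \<subseteq> S\<rbrakk> \<Longrightarrow> carrier H \<subseteq> S"
    and \<Psi>: "\<Psi> \<in> hom H (universal_completion A)"
    and \<Psi>_gen: "\<And>j g. \<lbrakk>j \<in> index A; g \<in> carrier (grp A j)\<rbrakk> \<Longrightarrow>
       \<Psi> g = pres_rel (amalgam_gens A) (amalgam_rels A) `` {[((j, g), True)]}"
  shows "canonical_hom H \<in> iso (universal_completion A) H"
proof -
  let ?U = "universal_completion A" and ?S = "amalgam_gens A"
  let ?r = "pres_rel ?S (amalgam_rels A)"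
  let ?can = "canonical_hom H"
  interpret H: group H by (rule H)
  interpret U: group ?U unfolding universal_completion_def by (rule group_presented_group)
  interpret can: group_hom ?U H ?can
    by unfold_locales (rule canonical_hom_in_hom[OF H A])
  interpret \<Psi>: group_hom H ?U \<Psi> by unfold_locales (rule \<Psi>)
  have letter: "\<Psi> (if b then g else inv\<^bsub>H\<^esub> g) = ?r `` {[((j, g), b)]}" if jg: "(j, g) \<in> ?S" for j g b
  proof -
    have g: "g \<in> carrier H" using gens_carrier[OF H A jg] .
    have w: "[((j, g), c)] \<in> words ?S" for c using jg by (simp add: words_def)
    have pos: "\<Psi> g = ?r `` {[((j, g), True)]}" using jg by (intro \<Psi>_gen) (auto simp: amalgam_gens_def)
    have "?r `` {[((j, g), False)]} \<otimes>\<^bsub>?U\<^esub> ?r `` {[((j, g), True)]} = \<one>\<^bsub>?U\<^esub>"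
    proof -
      have "?r `` {[((j, g), False)]} \<otimes>\<^bsub>?U\<^esub> ?r `` {[((j, g), True)]}
          = ?r `` {[((j, g), False)] @ [((j, g), True)]}"
        unfolding universal_completion_def by (rule presented_mult[OF w w])
      also have "\<dots> = ?r `` {[]}"
        using pres_rel.cancel[OF jg, of False] by (intro equiv_class_eq[OF equiv_pres_rel]) simp
      finally show ?thesis by (simp add: universal_completion_def presented_group_def)
    qed
    moreover have "?r `` {[((j, g), c)]} \<in> carrier ?U" for c
      using w by (auto simp: universal_completion_def presented_group_def quotient_def)
    ultimately have "?r `` {[((j, g), False)]} = inv\<^bsub>?U\<^esub> (\<Psi> g)"
      using U.inv_equality pos by metis
    then show ?thesis using pos g by simp
  qed
  have word: "\<Psi> (word_value H w) = ?r `` {w}" if "w \<in> words ?S" for w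
    using that
  proof (induction w)
    case Nil
    then show ?case by (simp add: word_value_def universal_completion_def presented_group_def)
  next
    case (Cons a w)
    obtain j g b where a: "a = ((j, g), b)" by (cases a) auto
    have jg: "(j, g) \<in> ?S" and w: "w \<in> words ?S" "[a] \<in> words ?S"
      using Cons.prems by (auto simp: a words_def)
    have "g \<in> carrier H" using gens_carrier[OF H A jg] .
    then have "\<Psi> (word_value H (a # w)) = ?r `` {[a]} \<otimes>\<^bsub>?U\<^esub> ?r `` {w}"
      unfolding a word_value_Cons[OF H A]
      using letter[OF jg, of b] Cons.IH[OF w(1)] word_value_closed[OF H A w(1)]
      by (subst \<Psi>.hom_mult) auto
    also have "\<dots> = ?r `` {a # w}"
      using presented_mult[OF w(2,1)] by (simp add: universal_completion_def)
    finally show ?case .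
  qed
  have left_inv: "\<Psi> (?can x) = x" if "x \<in> carrier ?U" for x
  proof -
    obtain w where "w \<in> words ?S" "x = ?r `` {w}"
      using \<open>x \<in> carrier ?U\<close> by (auto simp: universal_completion_def presented_group_def quotient_def)
    then show ?thesis using word canonical_hom_class[OF H A] by simp
  qed
  have "carrier (grp A j) \<subseteq> ?can ` carrier ?U" if j: "j \<in> index A" for j
  proof
    fix g assume g: "g \<in> carrier (grp A j)"
    have "(j, g) \<in> ?S" using j g by (simp add: amalgam_gens_def)
    then have "?r `` {[((j, g), True)]} \<in> carrier ?U"
      by (auto simp: universal_completion_def presented_group_def quotient_def words_def)
    then show "g \<in> ?can ` carrier ?U"
      using canonical_hom_generator[OF H A j g] by (metis image_eqI)
  qed
  then have "carrier H \<subseteq> ?can ` carrier ?U" using gen can.img_is_subgroup by blast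
  then have "bij_betw ?can (carrier ?U) (carrier H)"
    using left_inv can.hom_closed by (intro bij_betwI') (metis, auto)
  then show ?thesis using can.homh by (simp add: iso_def)
qed

context hall_geometry
begin

lemma trivial_rank:
  assumes "rank \<Gamma> = 0"
  shows "G = {\<one>\<^bsub>aut_group \<Gamma>\<^esub>}"
proof -
  have "elts \<Gamma> = {}" using assms finite_types ty_elts by (simp add: rank_def)
  then have "G \<subseteq> {\<one>\<^bsub>aut_group \<Gamma>\<^esub>}"
    using subgroup.subset[OF G] by (auto simp: aut_group_def geom_auts_def Bij_def BijGroup_def restrict_def)
  then show ?thesis using one_G by blast
qed

text \<open>The groups of the amalgam are those of the flags of size at least \<open>m = max 1 (|I| - k)\<close>, the empty
  flag being excluded also for \<open>k = |I|\<close>. A flag with fewer than \<open>m\<close> elements has a residue of rank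
  at least \<open>k\<close>. In rank 0 there is no flag of size \<open>m = 1\<close>, and the induction cannot start; but then \<open>G\<close>
  acts on the empty set and is trivial.\<close>

theorem completion_of_parabolics:
  assumes k: "k \<le> rank \<Gamma>"
    and sc: "\<And>U. \<lbrakk>U \<subseteq> W; flag \<Gamma> U; k \<le> rank (residue \<Gamma> U)\<rbrakk> \<Longrightarrow> simply_connected_geom (residue \<Gamma> U)"
  shows "canonical_hom (aut_subgroup \<Gamma> G) \<in>
    iso (universal_completion (parabolic_amalgam_rank k \<Gamma> G W)) (aut_subgroup \<Gamma> G)"
proof -
  define m where "m = max 1 (rank \<Gamma> - k)"
  let ?A = "parabolic_amalgam_rank k \<Gamma> G W"
  let ?K = "universal_completion ?A"
  let ?r = "pres_rel (amalgam_gens ?A) (amalgam_rels ?A)"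
  have index: "index ?A = W_flags m"
    by (auto simp: parabolic_amalgam_rank_def subamalgam_def parabolic_amalgam_def
        W_flags_def m_def Suc_le_eq card_gt_0_iff flag_finite)
  have grp: "grp ?A U = stab_group U" for U
    by (simp add: parabolic_amalgam_rank_def subamalgam_def parabolic_amalgam_def)
  have arrows: "(V, U) \<in> arrows ?A" if "U \<in> W_flags m" "V \<in> W_flags m" "U \<subseteq> V" for U V
    using that index
    by (auto simp: parabolic_amalgam_rank_def subamalgam_def parabolic_amalgam_def W_flags_def)
  have amap: "amap ?A V U g = g" for V U g
    by (simp add: parabolic_amalgam_rank_def subamalgam_def parabolic_amalgam_def)
  have A: "subgroup_amalgam (aut_subgroup \<Gamma> G) ?A"
    unfolding parabolic_amalgam_rank_def
    by (intro subgroup_amalgam_subamalgam subgroup_amalgam_parabolic G)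
  have K: "group ?K" unfolding universal_completion_def by (rule group_presented_group)
  define \<phi> where "\<phi> U g = ?r `` {[((U, g), True)]}" for U g
  have w: "[((U, g), True)] \<in> words (amalgam_gens ?A)" if "U \<in> W_flags m" "g \<in> parabolic G U" for U g
    using that by (simp add: words_def amalgam_gens_def index grp)
  have family: "compatible_family ?K m \<phi>"
    unfolding compatible_family_def
  proof (intro conjI ballI impI)
    fix U assume U: "U \<in> W_flags m"
    have Ux: "U \<subseteq> elts \<Gamma>" using U by (auto simp: W_flags_def flag_def)
    interpret H: group "stab_group U" by (rule group_stab[OF Ux])
    show "\<phi> U \<in> hom (stab_group U) ?K"
    proof (rule homI)
      fix g assume "g \<in> carrier (stab_group U)"
      then show "\<phi> U g \<in> carrier ?K" using w[OF U]
        by (auto simp: \<phi>_def universal_completion_def presented_group_def quotient_def)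
    next
      fix g h assume gh: "g \<in> carrier (stab_group U)" "h \<in> carrier (stab_group U)"
      let ?p = "g \<otimes>\<^bsub>stab_group U\<^esub> h"
      have p: "?p \<in> parabolic G U" using H.m_closed[OF gh] by simp
      have "([((U, g), True), ((U, h), True)], [((U, ?p), True)]) \<in> amalgam_rels ?A"
        unfolding amalgam_rels_def using U gh index grp by auto
      then have "([((U, g), True)] @ [((U, h), True)], [((U, ?p), True)]) \<in> ?r"
        using w[OF U] p gh by (intro pres_rel.relator) (auto simp: words_def)
      from equiv_class_eq[OF equiv_pres_rel this]
      show "\<phi> U ?p = \<phi> U g \<otimes>\<^bsub>?K\<^esub> \<phi> U h"
        using presented_mult[OF w[OF U] w[OF U]] gh unfolding \<phi>_def universal_completion_def by simp
    qed
  next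
    fix U V g assume UV: "U \<in> W_flags m" "V \<in> W_flags m" "U \<subseteq> V" and g: "g \<in> parabolic G V"
    have g': "g \<in> parabolic G U" using g UV(3) by (auto simp: parabolic_def)
    have "([((V, g), True)], [((U, amap ?A V U g), True)]) \<in> amalgam_rels ?A"
      unfolding amalgam_rels_def using arrows[OF UV] g grp by auto
    then have "([((V, g), True)], [((U, g), True)]) \<in> ?r"
      using w UV g g' by (intro pres_rel.relator) (auto simp: amap)
    then show "\<phi> V g = \<phi> U g" unfolding \<phi>_def by (rule equiv_class_eq[OF equiv_pres_rel])
  qed
  show ?thesis
  proof (cases "rank \<Gamma> = 0")
    case True
    note G1 = trivial_rank[OF True]
    interpret K: group ?K by (rule K)
    have none: "U \<notin> W_flags m" for U
      using True flag_card[of U] flag_types[of U] finite_types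
      by (auto simp: W_flags_def rank_def m_def)
    show ?thesis
    proof (rule canonical_hom_iso[OF group_G A, of "\<lambda>_. \<one>\<^bsub>?K\<^esub>"])
      show "carrier (aut_subgroup \<Gamma> G) \<subseteq> S" if "subgroup S (aut_subgroup \<Gamma> G)" for S
        using subgroup.one_closed[OF that] G1 by simp
      show "(\<lambda>_. \<one>\<^bsub>?K\<^esub>) \<in> hom (aut_subgroup \<Gamma> G) ?K" by (simp add: hom_def)
    qed (use none index in auto)
  next
    case False
    have m: "m \<le> rank \<Gamma>" using False by (simp add: m_def)
    have sc': "simply_connected_geom (residue \<Gamma> U)" if U: "U \<subseteq> W" "flag \<Gamma> U" "card U < m" for U
    proof -
      have "k \<le> rank \<Gamma> - card U" using U(3) k by (auto simp: m_def max_def split: if_splits)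
      then show ?thesis using sc[OF U(1,2)] rank_residue[OF U(2)] by simp
    qed
    obtain \<Phi> where \<Phi>: "\<Phi> \<in> hom (aut_subgroup \<Gamma> G) ?K"
      "\<And>U g. \<lbrakk>U \<in> W_flags m; g \<in> parabolic G U\<rbrakk> \<Longrightarrow> \<Phi> g = \<phi> U g"
      using compatible_family_extends[OF K m sc' family] by metis
    show ?thesis
    proof (rule canonical_hom_iso[OF group_G A _ \<Phi>(1)])
      show "carrier (aut_subgroup \<Gamma> G) \<subseteq> S"
        if S: "subgroup S (aut_subgroup \<Gamma> G)" "\<And>U. U \<in> index ?A \<Longrightarrow> carrier (grp ?A U) \<subseteq> S" for S
        using parabolics_generate[OF S(1) m] sc' S(2)
        by (simp add: index grp simply_connected_geom_def)
      show "\<Phi> g = ?r `` {[((U, g), True)]}" if "U \<in> index ?A" "g \<in> carrier (grp ?A U)" for U g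
        using \<Phi>(2)[of U g] that by (simp add: index grp \<phi>_def)
    qed
  qed
qed

end

theorem corollary3p4:
  fixes \<Gamma> :: "('x, 'i) pregeom"
    and G :: "('x \<Rightarrow> 'x) set"
    and t :: "'i \<Rightarrow> nat"
    and w :: "'i \<Rightarrow> nat \<Rightarrow> 'x"
    and W :: "'x set"
    and k :: nat
  assumes "geometry \<Gamma>"
    and "finite (types \<Gamma>)"
    and "subgroup G (aut_group \<Gamma>)"
    and "\<And>i. i \<in> types \<Gamma> \<Longrightarrow> orbit_representatives \<Gamma> G i (t i) (w i)"
    and "W = (\<Union>i\<in>types \<Gamma>. w i ` {1..t i})"
    and "hall \<Gamma> W"
    and "\<And>V. V \<subseteq> W \<Longrightarrow> flag \<Gamma> V \<Longrightarrow> flag_transitive G (orbit_pregeom \<Gamma> G V)"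
    and "k \<le> rank \<Gamma>"
    and "\<And>U. U \<subseteq> W \<Longrightarrow> flag \<Gamma> U \<Longrightarrow> k \<le> rank (residue \<Gamma> U) \<Longrightarrow>
           simply_connected_geom (residue \<Gamma> U)"
  shows "canonical_hom (aut_subgroup \<Gamma> G) \<in>
           iso (universal_completion (parabolic_amalgam \<Gamma> G W)) (aut_subgroup \<Gamma> G) \<and>
         canonical_hom (aut_subgroup \<Gamma> G) \<in>
           iso (universal_completion (parabolic_amalgam_rank k \<Gamma> G W)) (aut_subgroup \<Gamma> G)"
proof -
  interpret hall_geometry \<Gamma> G W
  proof (rule hall_geometry.intro)
    fix x assume x: "x \<in> elts \<Gamma>"
    let ?i = "ty \<Gamma> x"
    have i: "?i \<in> types \<Gamma>" using x assms(1) by (auto simp: geometry_def pregeometry_def)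
    have ex1: "\<exists>!j. j \<in> {1..t ?i} \<and> x \<in> geom_orbit \<Gamma> G (w ?i j)"
      using assms(4)[OF i] x by (simp add: orbit_representatives_def)
    then obtain j where j: "j \<in> {1..t ?i}" "x \<in> geom_orbit \<Gamma> G (w ?i j)" by blast
    have j_unique: "j' = j" if "j' \<in> {1..t ?i}" "x \<in> geom_orbit \<Gamma> G (w ?i j')" for j'
      using ex1 j that by blast
    show "\<exists>!w. w \<in> W \<and> x \<in> geom_orbit \<Gamma> G w"
    proof (rule ex1I[of _ "w ?i j"])
      show "w ?i j \<in> W \<and> x \<in> geom_orbit \<Gamma> G (w ?i j)" using i j assms(5) by blast
    next
      fix v assume v: "v \<in> W \<and> x \<in> geom_orbit \<Gamma> G v"
      then obtain i' j' where ij: "i' \<in> types \<Gamma>" "j' \<in> {1..t i'}" "v = w i' j'"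
        using assms(5) by blast
      have v': "v \<in> elts \<Gamma>" "ty \<Gamma> v = i'"
        using assms(4)[OF ij(1)] ij by (auto simp: orbit_representatives_def)
      obtain g where g: "g \<in> G" "x = g v" using v by (auto simp: orbit_def)
      have "g \<in> geom_auts \<Gamma>" using subgroup.subset[OF assms(3)] g by (auto simp: aut_group_def)
      then have "i' = ?i" using g v' by (simp add: geom_auts_def)
      then show "v = w ?i j" using j_unique ij v by auto
    qed
  qed (use assms(1-3,6,7) in blast)+
  have "parabolic_amalgam \<Gamma> G W = parabolic_amalgam_rank (rank \<Gamma>) \<Gamma> G W"
    by (simp add: parabolic_amalgam_rank_def subamalgam_def parabolic_amalgam_def)
  then show ?thesis
    using completion_of_parabolics[of "rank \<Gamma>"] completion_of_parabolics[of k] assms(8,9)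
    by (simp add: order_trans)
qed

end
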